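(* Let $V$ be a complex vector space of finite dimension $N$ with a fixed basis $\{v^i\}_{i=1}^N$, and let $\hat R\in\mathrm{Aut}(V^{\otimes 2})$ be a skew invertible R-matrix of BMW type with parameters $q\in\mathbb C\setminus\{0,\pm1\}$, $\nu\in\mathbb C\setminus\{0,q,-q^{-1}\}$. Let $\hat K:=\lambda^{-1}\nu^{-1}(qI-\hat R)(q^{-1}I+\hat R)$, $\lambda:=q-q^{-1}$, with matrix $\hat K_{ij}^{kl}=\bar g_{ij}\,g^{kl}$, and let $X\in\mathrm{End}(V)$ be the (invertible) operator with matrix $X_i^j:=\sum_k g^{jk}\bar g_{ki}$. Let $\mathcal F(\hat R)$ be the bialgebra generated by the entries of $T=\|T_i^j\|_{i,j=1}^N$ subject to $\hat R_{12}T_1T_2=T_1T_2\hat R_{12}$, and let $\tau\in\mathcal F(\hat R)$ be the element determined by $$\hat K_{12}T_1T_2=\tau\,\hat K_{12}.$$ Then $\tau$ is group-like, i.e. $\triangle(\tau)=\tau\otimes\tau$ and $\varepsilon(\tau)=1$, and it satisfies, for all $1\le i,j\le N$, $$\tau\,T_i^j=(XTX^{-1})_i^j\,\tau .$$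
   Context: Notation. For $A\in\mathrm{End}(V^{\otimes 2})$ and $1\le k\ne l\le n$, $A_{kl}\in\mathrm{End}(V^{\otimes n})$ acts as $A$ on the tensor product of the $k$-th and $l$-th factors and as the identity on the other factors; $A_k:=A_{k\,k+1}$. $I$ is the identity operator, $P$ is the permutation $P(u\otimes v)=v\otimes u$, and $\mathrm{Tr}_{(i)}$ is the partial trace over the $i$-th tensor factor. Matrix conventions. Lower indices are row indices and upper indices are column indices: $A\in\mathrm{End}(V)$ has matrix $A_i^j$ with $A(v^j)=\sum_i v^iA_i^j$, so $(AB)_i^j=\sum_kA_i^kB_k^j$; likewise $\hat K(v^k\otimes v^l)=\sum_{i,j}\hat K_{ij}^{kl}\,v^i\otimes v^j$, and similarly for $\hat R$. For the matrix $T$ with entries in a noncommutative algebra, $T_1$ (resp. $T_2$) denotes $T$ acting in the first (resp. second) tensor factor, so $(T_1T_2)_{ij}^{kl}=T_i^kT_j^l$ (product in this order), and $(XTX^{-1})_i^j=\sum_{k,l}X_i^k\,T_k^l\,(X^{-1})_l^j$. R-matrix. An element $\hat R\in\mathrm{Aut}(V^{\otimes 2})$ is an R-matrix if $\hat R_1\hat R_2\hat R_1=\hat R_2\hat R_1\hat R_2$ in $\mathrm{End}(V^{\otimes 3})$. Skew invertibility. $\hat R\in\mathrm{Aut}(V^{\otimes 2})$ is skew invertible if there exists $\hat\Psi\in\mathrm{End}(V^{\otimes 2})$ with $\mathrm{Tr}_{(2)}(\hat R_{12}\hat\Psi_{23})=\mathrm{Tr}_{(2)}(\hat\Psi_{12}\hat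 R_{23})=P_{13}$. Birman-Murakami-Wenzl algebra. For $q\in\mathbb C\setminus\{0,\pm1\}$, $\nu\in\mathbb C\setminus\{0,q,-q^{-1}\}$, $\lambda:=q-q^{-1}$, the algebra $W_n(q,\nu)$ is the quotient of the group algebra of the braid group on $n$ strands, given by generators $e_i$ (invertible) and $\kappa_i$, $i=1,\dots,n-1$, and relations $$e_ie_{i+1}e_i=e_{i+1}e_ie_{i+1},\qquad e_ie_j=e_je_i\ (|i-j|>1),\qquad e_i^2=1+\lambda(e_i-\nu\kappa_i),$$ $$e_i\kappa_i=\kappa_ie_i=\nu\kappa_i,\qquad \kappa_{i+1}e_i\kappa_{i+1}=\nu^{-1}\kappa_{i+1},\qquad \kappa_{i+1}e_i^{-1}\kappa_{i+1}=\nu\,\kappa_{i+1}.$$ In particular $\kappa_i=\lambda^{-1}\nu^{-1}(q-e_i)(q^{-1}+e_i)$ and $\kappa_i^2=\mu\kappa_i$ with $\mu:=\lambda^{-1}\nu^{-1}(q-\nu)(q^{-1}+\nu)\neq0$. BMW type. An R-matrix $\hat R$ is of BMW type (with parameters $q,\nu$) if its minimal polynomial has degree $3$ and, for every $n$, the assignment $e_i\mapsto\hat R_i$ (hence $\kappa_i\mapsto\hat K_i$) defines a representation of $W_n(q,\nu)$ on $V^{\otimes n}$. Rank one. For a skew invertible BMW type R-matrix the operator $\hat K$ has rank $1$, so its matrix factorizes as $\hat K_{ij}^{kl}=\bar g_{ij}g^{kl}$, with $(\bar g,g)$ unique up to $(\bar g,g)\mapsto(c\bar g,c^{-1}g)$,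 $c\in\mathbb C\setminus\{0\}$; the operator $X$ does not depend on this choice and is invertible, its inverse having matrix $\sum_k\bar g_{ik}g^{kj}$. The bialgebra $\mathcal F(\hat R)$. It is the associative unital $\mathbb C$-algebra generated by $T_i^j$, $1\le i,j\le N$, subject to the relations $\hat R_{12}T_1T_2=T_1T_2\hat R_{12}$, with coproduct and counit the algebra homomorphisms given by $\triangle(T_i^j)=\sum_{k=1}^NT_i^k\otimes T_k^j$ and $\varepsilon(T_i^j)=\delta_i^j$. Because $\hat K$ is a polynomial in $\hat R$, has rank one and satisfies $\hat K^2=\mu\hat K$, one has $\hat K_{12}T_1T_2=\mu^{-1}\hat K_{12}T_1T_2\hat K_{12}=\tau\hat K_{12}$ for a unique $\tau\in\mathcal F(\hat R)$. *)

theory Defs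
  imports
    "HOL-Analysis.Analysis"
    "HOL-Computational_Algebra.Polynomial"
    "HOL-Library.Poly_Mapping"
    "HOL-Algebra.QuotRing"
    "HOL-Algebra.Module"
begin

section \<open>Operators on tensor products of copies of \<open>V\<close>\<close>

text \<open>
  \<open>V\<close> is the complex vector space with basis \<open>v\<^sup>i\<close>, \<open>i :: 'n\<close>. An operator on \<open>V\<close> is a matrix
  \<open>complex^'n^'n\<close> and an operator on \<open>V \<otimes> V\<close> a matrix \<open>complex^('n \<times> 'n)^('n \<times> 'n)\<close>, the first index
  being the row: \<open>A $ (i, j) $ (k, l)\<close> is the coefficient of \<open>v\<^sup>i \<otimes> v\<^sup>j\<close> in \<open>A (v\<^sup>k \<otimes> v\<^sup>l)\<close>.

  For a finite set \<open>S\<close> of natural numbers (the labels of the tensor factors), the tensor product of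
  the copies of \<open>V\<close> labelled by \<open>S\<close> has the basis \<open>tensor_index S\<close>. Operators on it are matrices
  over this basis which vanish outside of it. Thus \<open>S = {1..n}\<close> gives the \<open>n\<close>-th tensor power, and
  the partial trace over factor \<open>i\<close> maps operators for \<open>S\<close> to operators for \<open>S - {i}\<close>.
\<close>

definition tensor_index :: "nat set \<Rightarrow> (nat \<Rightarrow> 'n) set" where
  "tensor_index S = S \<rightarrow>\<^sub>E UNIV"

type_synonym 'n tensor_op = "(nat \<Rightarrow> 'n) \<Rightarrow> (nat \<Rightarrow> 'n) \<Rightarrow> complex"

definition tensor_End :: "nat set \<Rightarrow> (complex, 'n tensor_op) module" where
  "tensor_End S =
    \<lparr>carrier = {M. \<forall>a b. M a b \<noteq> 0 \<longrightarrow> a \<in> tensor_index S \<and> b \<in> tensor_index S},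
     mult = (\<lambda>M M' a b. \<Sum>c\<in>tensor_index S. M a c * M' c b),
     one = (\<lambda>a b. if a \<in> tensor_index S \<and> a = b then 1 else 0),
     zero = (\<lambda>a b. 0),
     add = (\<lambda>M M' a b. M a b + M' a b),
     smult = (\<lambda>z M a b. z * M a b)\<rparr>"

definition on_factors ::
    "nat set \<Rightarrow> complex^('n::finite \<times> 'n)^('n \<times> 'n) \<Rightarrow> nat \<Rightarrow> nat \<Rightarrow> 'n tensor_op" where
  "on_factors S A k l = (\<lambda>a b.
     if a \<in> tensor_index S \<and> b \<in> tensor_index S \<and> (\<forall>m\<in>S - {k, l}. a m = b m)
     then A $ (a k, a l) $ (b k, b l) else 0)"

definition partial_trace :: "nat set \<Rightarrow> nat \<Rightarrow> 'n::finite tensor_op \<Rightarrow> 'n tensor_op" where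
  "partial_trace S i M = (\<lambda>a b.
     if a \<in> tensor_index (S - {i}) \<and> b \<in> tensor_index (S - {i})
     then \<Sum>x\<in>UNIV. M (a(i := x)) (b(i := x)) else 0)"

definition flip :: "complex^('n::finite \<times> 'n)^('n \<times> 'n)" where
  "flip = (\<chi> r c. if fst r = snd c \<and> snd r = fst c then 1 else 0)"


section \<open>R-matrices\<close>

definition R_matrix :: "complex^('n::finite \<times> 'n)^('n \<times> 'n) \<Rightarrow> bool" where
  "R_matrix R \<longleftrightarrow> invertible R \<and>
    (let E = tensor_End {1..3}; R1 = on_factors {1..3} R 1 2; R2 = on_factors {1..3} R 2 3
     in R1 \<otimes>\<^bsub>E\<^esub> R2 \<otimes>\<^bsub>E\<^esub> R1 = R2 \<otimes>\<^bsub>E\<^esub> R1 \<otimes>\<^bsub>E\<^esub> R2)"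

definition skew_invertible :: "complex^('n::finite \<times> 'n)^('n \<times> 'n) \<Rightarrow> bool" where
  "skew_invertible R \<longleftrightarrow> invertible R \<and>
    (\<exists>\<Psi>. partial_trace {1..3} 2
            (on_factors {1..3} R 1 2 \<otimes>\<^bsub>tensor_End {1..3}\<^esub> on_factors {1..3} \<Psi> 2 3)
          = on_factors {1, 3} flip 1 3 \<and>
         partial_trace {1..3} 2
            (on_factors {1..3} \<Psi> 1 2 \<otimes>\<^bsub>tensor_End {1..3}\<^esub> on_factors {1..3} R 2 3)
          = on_factors {1, 3} flip 1 3)"

definition poly_matrix :: "complex poly \<Rightarrow> complex^'m^'m \<Rightarrow> complex^'m^('m::finite)" where
  "poly_matrix p A = (\<Sum>i\<le>degree p. mat (coeff p i) ** (((**) A) ^^ i) (mat 1))"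

definition is_minimal_polynomial :: "complex poly \<Rightarrow> complex^'m^('m::finite) \<Rightarrow> bool" where
  "is_minimal_polynomial p A \<longleftrightarrow>
    lead_coeff p = 1 \<and> poly_matrix p A = 0 \<and>
    (\<forall>r. r \<noteq> 0 \<and> poly_matrix r A = 0 \<longrightarrow> degree p \<le> degree r)"

definition K_hat :: "complex \<Rightarrow> complex \<Rightarrow> complex^('n::finite \<times> 'n)^('n \<times> 'n)
    \<Rightarrow> complex^('n \<times> 'n)^('n \<times> 'n)" where
  "K_hat q \<nu> R =
    mat (inverse (q - inverse q) * inverse \<nu>) ** (mat q - R) ** (mat (inverse q) + R)"

text \<open>
  A representation of the Birman-Murakami-Wenzl algebra \<open>W\<^sub>n(q, \<nu>)\<close> in a complex algebra \<open>A\<close>: images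
  \<open>e i\<close>, \<open>\<kappa> i\<close> of its generators (\<open>1 \<le> i < n\<close>) which satisfy its defining relations.
\<close>

definition BMW_representation :: "(complex, 'a) module \<Rightarrow> nat \<Rightarrow> complex \<Rightarrow> complex
    \<Rightarrow> (nat \<Rightarrow> 'a) \<Rightarrow> (nat \<Rightarrow> 'a) \<Rightarrow> bool" where
  "BMW_representation A n q \<nu> e \<kappa> \<longleftrightarrow>
    (\<forall>i\<in>{1..<n}. e i \<in> Units A \<and> \<kappa> i \<in> carrier A) \<and>
    (\<forall>i. 1 \<le> i \<and> i + 1 < n \<longrightarrow>
       e i \<otimes>\<^bsub>A\<^esub> e (i + 1) \<otimes>\<^bsub>A\<^esub> e i = e (i + 1) \<otimes>\<^bsub>A\<^esub> e i \<otimes>\<^bsub>A\<^esub> e (i + 1)) \<and>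
    (\<forall>i\<in>{1..<n}. \<forall>j\<in>{1..<n}. i + 1 < j \<or> j + 1 < i \<longrightarrow>
       e i \<otimes>\<^bsub>A\<^esub> e j = e j \<otimes>\<^bsub>A\<^esub> e i) \<and>
    (\<forall>i\<in>{1..<n}.
       e i \<otimes>\<^bsub>A\<^esub> e i = \<one>\<^bsub>A\<^esub> \<oplus>\<^bsub>A\<^esub> (q - inverse q) \<odot>\<^bsub>A\<^esub> (e i \<ominus>\<^bsub>A\<^esub> \<nu> \<odot>\<^bsub>A\<^esub> \<kappa> i)) \<and>
    (\<forall>i\<in>{1..<n}.
       e i \<otimes>\<^bsub>A\<^esub> \<kappa> i = \<nu> \<odot>\<^bsub>A\<^esub> \<kappa> i \<and> \<kappa> i \<otimes>\<^bsub>A\<^esub> e i = \<nu> \<odot>\<^bsub>A\<^esub> \<kappa> i) \<and>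
    (\<forall>i. 1 \<le> i \<and> i + 1 < n \<longrightarrow>
       \<kappa> (i + 1) \<otimes>\<^bsub>A\<^esub> e i \<otimes>\<^bsub>A\<^esub> \<kappa> (i + 1) = inverse \<nu> \<odot>\<^bsub>A\<^esub> \<kappa> (i + 1) \<and>
       \<kappa> (i + 1) \<otimes>\<^bsub>A\<^esub> inv\<^bsub>A\<^esub> (e i) \<otimes>\<^bsub>A\<^esub> \<kappa> (i + 1) = \<nu> \<odot>\<^bsub>A\<^esub> \<kappa> (i + 1))"

definition BMW_type :: "complex \<Rightarrow> complex \<Rightarrow> complex^('n::finite \<times> 'n)^('n \<times> 'n) \<Rightarrow> bool" where
  "BMW_type q \<nu> R \<longleftrightarrow> R_matrix R \<and>
    (\<exists>p. is_minimal_polynomial p R \<and> degree p = 3) \<and>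
    (\<forall>n. BMW_representation (tensor_End {1..n}) n q \<nu>
           (\<lambda>i. on_factors {1..n} R i (i + 1))
           (\<lambda>i. on_factors {1..n} (K_hat q \<nu> R) i (i + 1)))"


section \<open>Complex algebras\<close>

text \<open>
  Complex unital associative algebras are given by the record \<open>(complex, 'a) module\<close>, i.e. a ring
  together with a scalar multiplication.
\<close>

definition algebra_hom :: "(complex, 'a) module \<Rightarrow> (complex, 'b) module \<Rightarrow> ('a \<Rightarrow> 'b) set" where
  "algebra_hom A B =
    {h \<in> ring_hom A B. \<forall>c. \<forall>x\<in>carrier A. h (c \<odot>\<^bsub>A\<^esub> x) = c \<odot>\<^bsub>B\<^esub> h x}"

definition complex_algebra :: "(complex, complex) module" where
  "complex_algebra =
    \<lparr>carrier = UNIV, mult = (*), one = 1, zero = 0, add = (+), smult = (*)\<rparr>"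

definition monoid_algebra :: "('a, 'm) monoid_scheme \<Rightarrow> (complex, 'a \<Rightarrow>\<^sub>0 complex) module" where
  "monoid_algebra M =
    \<lparr>carrier = {p. Poly_Mapping.keys p \<subseteq> carrier M},
     mult = (\<lambda>p r. \<Sum>x\<in>Poly_Mapping.keys p. \<Sum>y\<in>Poly_Mapping.keys r.
       Poly_Mapping.single (x \<otimes>\<^bsub>M\<^esub> y) (Poly_Mapping.lookup p x * Poly_Mapping.lookup r y)),
     one = Poly_Mapping.single \<one>\<^bsub>M\<^esub> 1,
     zero = 0,
     add = (+),
     smult = (\<lambda>c. Poly_Mapping.map ((*) c))\<rparr>"

definition quotient_algebra :: "(complex, 'a) module \<Rightarrow> 'a set \<Rightarrow> (complex, 'a set) module" where
  "quotient_algebra A I =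
    \<lparr>carrier = carrier (A Quot I), mult = mult (A Quot I), one = one (A Quot I),
     zero = zero (A Quot I), add = add (A Quot I),
     smult = (\<lambda>c C. \<Union>x\<in>C. I +>\<^bsub>A\<^esub> (c \<odot>\<^bsub>A\<^esub> x))\<rparr>"

definition free_algebra :: "(complex, 'g list \<Rightarrow>\<^sub>0 complex) module" where
  "free_algebra = monoid_algebra \<lparr>carrier = UNIV, mult = (@), one = []\<rparr>"

text \<open>
  The tensor product over the complex numbers of two algebras: the free vector space on the pairs
  \<open>(a, b)\<close>, multiplied by \<open>(a, b) (a', b') = (a a', b b')\<close>, modulo bilinearity. The set of bilinearity
  relators is stable under multiplication by pairs, so the ideal it generates is its linear span.
\<close>

definition bilinear_relators ::
    "(complex, 'a) module \<Rightarrow> (complex, 'b) module \<Rightarrow> ('a \<times> 'b \<Rightarrow>\<^sub>0 complex) set" where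
  "bilinear_relators A B =
    {Poly_Mapping.single (a \<oplus>\<^bsub>A\<^esub> a', b) 1 - Poly_Mapping.single (a, b) 1 - Poly_Mapping.single (a', b) 1
      |a a' b. a \<in> carrier A \<and> a' \<in> carrier A \<and> b \<in> carrier B} \<union>
    {Poly_Mapping.single (a, b \<oplus>\<^bsub>B\<^esub> b') 1 - Poly_Mapping.single (a, b) 1 - Poly_Mapping.single (a, b') 1
      |a b b'. a \<in> carrier A \<and> b \<in> carrier B \<and> b' \<in> carrier B} \<union>
    {Poly_Mapping.single (c \<odot>\<^bsub>A\<^esub> a, b) 1 - Poly_Mapping.single (a, b) c
      |a b c. a \<in> carrier A \<and> b \<in> carrier B} \<union>
    {Poly_Mapping.single (a, c \<odot>\<^bsub>B\<^esub> b) 1 - Poly_Mapping.single (a, b) c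
      |a b c. a \<in> carrier A \<and> b \<in> carrier B}"

definition bilinear_ideal ::
    "(complex, 'a) module \<Rightarrow> (complex, 'b) module \<Rightarrow> ('a \<times> 'b \<Rightarrow>\<^sub>0 complex) set" where
  "bilinear_ideal A B = Idl\<^bsub>monoid_algebra (A \<times>\<times> B)\<^esub> (bilinear_relators A B)"

definition tensor_algebra ::
    "(complex, 'a) module \<Rightarrow> (complex, 'b) module \<Rightarrow> (complex, ('a \<times> 'b \<Rightarrow>\<^sub>0 complex) set) module" where
  "tensor_algebra A B = quotient_algebra (monoid_algebra (A \<times>\<times> B)) (bilinear_ideal A B)"

definition pure_tensor ::
    "(complex, 'a) module \<Rightarrow> (complex, 'b) module \<Rightarrow> 'a \<Rightarrow> 'b \<Rightarrow> ('a \<times> 'b \<Rightarrow>\<^sub>0 complex) set" where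
  "pure_tensor A B a b =
    bilinear_ideal A B +>\<^bsub>monoid_algebra (A \<times>\<times> B)\<^esub> Poly_Mapping.single (a, b) 1"


section \<open>The bialgebra \<open>F(R)\<close>\<close>

text \<open>
  The letter \<open>(i, j)\<close> of the free algebra stands for the generator with row index \<open>i\<close> and column
  index \<open>j\<close>; the relators are the matrix entries of \<open>R T\<^sub>1 T\<^sub>2 - T\<^sub>1 T\<^sub>2 R\<close>.
\<close>

definition FRT_relators ::
    "complex^('n::finite \<times> 'n)^('n \<times> 'n) \<Rightarrow> (('n \<times> 'n) list \<Rightarrow>\<^sub>0 complex) set" where
  "FRT_relators R =
    {(\<Sum>a\<in>UNIV. \<Sum>b\<in>UNIV. Poly_Mapping.single [(a, k), (b, l)] (R $ (i, j) $ (a, b)))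
     - (\<Sum>a\<in>UNIV. \<Sum>b\<in>UNIV. Poly_Mapping.single [(i, a), (j, b)] (R $ (a, b) $ (k, l)))
     |i j k l. True}"

definition FRT_ideal ::
    "complex^('n::finite \<times> 'n)^('n \<times> 'n) \<Rightarrow> (('n \<times> 'n) list \<Rightarrow>\<^sub>0 complex) set" where
  "FRT_ideal R = Idl\<^bsub>free_algebra\<^esub> (FRT_relators R)"

definition FRT ::
    "complex^('n::finite \<times> 'n)^('n \<times> 'n) \<Rightarrow> (complex, (('n \<times> 'n) list \<Rightarrow>\<^sub>0 complex) set) module" where
  "FRT R = quotient_algebra free_algebra (FRT_ideal R)"

definition FRT_gen ::
    "complex^('n::finite \<times> 'n)^('n \<times> 'n) \<Rightarrow> 'n \<Rightarrow> 'n \<Rightarrow> (('n \<times> 'n) list \<Rightarrow>\<^sub>0 complex) set" where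
  "FRT_gen R i j = FRT_ideal R +>\<^bsub>free_algebra\<^esub> Poly_Mapping.single [(i, j)] 1"

definition coproduct ::
    "complex^('n::finite \<times> 'n)^('n \<times> 'n) \<Rightarrow> (('n \<times> 'n) list \<Rightarrow>\<^sub>0 complex) set
      \<Rightarrow> ((('n \<times> 'n) list \<Rightarrow>\<^sub>0 complex) set \<times> (('n \<times> 'n) list \<Rightarrow>\<^sub>0 complex) set \<Rightarrow>\<^sub>0 complex) set" where
  "coproduct R =
    (THE \<Delta>. \<Delta> \<in> algebra_hom (FRT R) (tensor_algebra (FRT R) (FRT R)) \<and>
       \<Delta> \<in> extensional (carrier (FRT R)) \<and>
       (\<forall>i j. \<Delta> (FRT_gen R i j) =
          (\<Oplus>\<^bsub>tensor_algebra (FRT R) (FRT R)\<^esub>k\<in>UNIV.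
             pure_tensor (FRT R) (FRT R) (FRT_gen R i k) (FRT_gen R k j))))"

definition counit ::
    "complex^('n::finite \<times> 'n)^('n \<times> 'n) \<Rightarrow> (('n \<times> 'n) list \<Rightarrow>\<^sub>0 complex) set \<Rightarrow> complex" where
  "counit R =
    (THE \<epsilon>. \<epsilon> \<in> algebra_hom (FRT R) complex_algebra \<and>
       \<epsilon> \<in> extensional (carrier (FRT R)) \<and>
       (\<forall>i j. \<epsilon> (FRT_gen R i j) = (if i = j then 1 else 0)))"

end

theory Submission
  imports Defs
begin

text \<open>
  Write \<open>Y\<close> for the matrix product of \<open>gbar\<close> and \<open>g\<close>. Since \<open>K\<close> has rank one,
  \<open>K\<^sub>2 A\<^sub>1 K\<^sub>2 = \<phi>(A)\<^sub>1 K\<^sub>2\<close> for an operator \<open>\<phi>(A)\<close> on \<open>V\<close> depending linearly on \<open>A\<close>. The BMW relations say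
  \<open>\<phi>(R) = \<nu>\<^sup>-\<^sup>1\<close> and \<open>\<phi>(R\<^sup>-\<^sup>1) = \<nu>\<close>, and \<open>R - R\<^sup>-\<^sup>1 = \<lambda> (1 - K)\<close> then gives \<open>\<phi>(K) = 1\<close>. As \<open>\<phi>(K) = Y X\<close>,
  this means \<open>Y = X\<^sup>-\<^sup>1\<close>.

  The relation defining \<open>\<tau>\<close> splits into \<open>g\<^sup>a\<^sup>b T\<^sub>a\<^sup>k T\<^sub>b\<^sup>l = g\<^sup>k\<^sup>l \<tau>\<close> and, because \<open>K\<close> is a polynomial in \<open>R\<close> and so
  commutes with \<open>T\<^sub>1 T\<^sub>2\<close>, \<open>gbar\<^sub>a\<^sub>b T\<^sub>i\<^sup>a T\<^sub>j\<^sup>b = gbar\<^sub>i\<^sub>j \<tau>\<close>. Contracting a triple product of generators in two ways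
  yields \<open>Y \<tau> T = T Y \<tau>\<close>, that is \<open>\<tau> T = X T X\<^sup>-\<^sup>1 \<tau>\<close>. Group-likeness follows by applying the coproduct and
  the counit to one nonzero entry of \<open>K T\<^sub>1 T\<^sub>2 = \<tau> K\<close>.
\<close>

lemma sum_pairs: "(\<Sum>a\<in>UNIV. \<Sum>b\<in>UNIV. f a b) = (\<Sum>r\<in>UNIV. f (fst r) (snd r))"
  for f :: "'a::finite \<Rightarrow> 'b::finite \<Rightarrow> 'c::comm_monoid_add"
  by (simp add: sum.cartesian_product case_prod_beta)

section \<open>Operators on the third tensor power\<close>

text \<open>The value \<open>undefined\<close> off the labels 1, 2, 3 matches the extensional
  functions that make up \<open>tensor_index {1..3}\<close>, so every basis index of the third
  tensor power has this form.\<close>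

definition index3 :: "'n \<Rightarrow> 'n \<Rightarrow> 'n \<Rightarrow> nat \<Rightarrow> 'n" where
  "index3 x y z = (\<lambda>m. if m = 1 then x else if m = 2 then y else if m = 3 then z else undefined)"

lemma index3_simps [simp]:
  "index3 x y z (Suc 0) = x" "index3 x y z 1 = x" "index3 x y z 2 = y" "index3 x y z 3 = z"
  by (simp_all add: index3_def)

lemma index3_in_tensor_index [simp]:
  "index3 x y z \<in> tensor_index {1..3}" "index3 x y z \<in> tensor_index {Suc 0..3}"
  by (auto simp: tensor_index_def index3_def)

lemma tensor_index3_eq:
  assumes "a \<in> tensor_index {1..3}"
  shows "a = index3 (a 1) (a 2) (a 3)"
proof
  fix m
  show "a m = index3 (a 1) (a 2) (a 3) m"
  proof (cases "m \<in> {1..3}")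
    case True
    then have "m = 1 \<or> m = 2 \<or> m = 3"
      by auto
    then show ?thesis
      by (auto simp: index3_def)
  next
    case False
    then show ?thesis
      using assms by (auto simp: tensor_index_def index3_def)
  qed
qed

lemma sum_tensor_index3:
  fixes f :: "(nat \<Rightarrow> 'n::finite) \<Rightarrow> complex"
  shows "(\<Sum>c\<in>tensor_index {1..3}. f c) = (\<Sum>x\<in>UNIV. \<Sum>y\<in>UNIV. \<Sum>z\<in>UNIV. f (index3 x y z))"
proof -
  have "(\<Sum>c\<in>tensor_index {1..3}. f c) = (\<Sum>(x, y, z)\<in>UNIV. f (index3 x y z))"
    by (rule sum.reindex_bij_witness[where i = "\<lambda>(x, y, z). index3 x y z" and j = "\<lambda>a. (a 1, a 2, a 3)"])
      (auto simp del: One_nat_def simp flip: tensor_index3_eq)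
  also have "\<dots> = (\<Sum>x\<in>UNIV. \<Sum>y\<in>UNIV. \<Sum>z\<in>UNIV. f (index3 x y z))"
    by (simp add: sum.cartesian_product flip: UNIV_Times_UNIV)
  finally show ?thesis .
qed

lemma tensor_End_simps:
  "carrier (tensor_End S) = {M. \<forall>a b. M a b \<noteq> 0 \<longrightarrow> a \<in> tensor_index S \<and> b \<in> tensor_index S}"
  "(M \<otimes>\<^bsub>tensor_End S\<^esub> N) a b = (\<Sum>c\<in>tensor_index S. M a c * N c b)"
  "\<one>\<^bsub>tensor_End S\<^esub> a b = (if a \<in> tensor_index S \<and> a = b then 1 else 0)"
  "(z \<odot>\<^bsub>tensor_End S\<^esub> M) a b = z * M a b"
  by (simp_all add: tensor_End_def)

text \<open>The monoid structure makes inverses in \<open>tensor_End S\<close> unique, which is how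
  the abstract \<open>inv\<close> of the BMW relations gets identified. Finiteness of
  \<open>S\<close> makes the basis finite, so sums against the unit matrix collapse.\<close>

lemma monoid_tensor_End:
  assumes "finite S"
  shows "Group.monoid (tensor_End S :: (complex, 'n::finite tensor_op) module)"
proof -
  have fin: "finite (tensor_index S :: (nat \<Rightarrow> 'n) set)"
    using assms by (simp add: tensor_index_def finite_PiE)
  show ?thesis
  proof (rule monoidI)
    fix M N :: "'n tensor_op"
    assume MN: "M \<in> carrier (tensor_End S)" "N \<in> carrier (tensor_End S)"
    have "a \<in> tensor_index S \<and> b \<in> tensor_index S" if "(M \<otimes>\<^bsub>tensor_End S\<^esub> N) a b \<noteq> 0" for a b
    proof -
      obtain c where "M a c * N c b \<noteq> 0"
        using \<open>(M \<otimes>\<^bsub>tensor_End S\<^esub> N) a b \<noteq> 0\<close> unfolding tensor_End_simps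
        by (rule sum.not_neutral_contains_not_neutral)
      then show ?thesis
        using MN unfolding tensor_End_simps mult_eq_0_iff by blast
    qed
    then show "M \<otimes>\<^bsub>tensor_End S\<^esub> N \<in> carrier (tensor_End S)"
      unfolding tensor_End_simps(1) by blast
  next
    fix M N L :: "'n tensor_op"
    show "M \<otimes>\<^bsub>tensor_End S\<^esub> N \<otimes>\<^bsub>tensor_End S\<^esub> L = M \<otimes>\<^bsub>tensor_End S\<^esub> (N \<otimes>\<^bsub>tensor_End S\<^esub> L)"
    proof (intro ext)
      fix a b
      show "(M \<otimes>\<^bsub>tensor_End S\<^esub> N \<otimes>\<^bsub>tensor_End S\<^esub> L) a b = (M \<otimes>\<^bsub>tensor_End S\<^esub> (N \<otimes>\<^bsub>tensor_End S\<^esub> L)) a b"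
        unfolding tensor_End_simps sum_distrib_left sum_distrib_right
        by (subst sum.swap) (simp add: mult.assoc)
    qed
  next
    fix M :: "'n tensor_op"
    assume "M \<in> carrier (tensor_End S)"
    then have M: "M a b = 0" if "a \<notin> tensor_index S \<or> b \<notin> tensor_index S" for a b
      using that by (auto simp: tensor_End_simps)
    show "\<one>\<^bsub>tensor_End S\<^esub> \<otimes>\<^bsub>tensor_End S\<^esub> M = M"
    proof (intro ext)
      fix a b
      have "(\<one>\<^bsub>tensor_End S\<^esub> \<otimes>\<^bsub>tensor_End S\<^esub> M) a b = (\<Sum>c\<in>tensor_index S. if a = c then M c b else 0)"
        unfolding tensor_End_simps by (rule sum.cong) auto
      then show "(\<one>\<^bsub>tensor_End S\<^esub> \<otimes>\<^bsub>tensor_End S\<^esub> M) a b = M a b"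
        using fin M[of a b] by (auto simp: sum.delta)
    qed
    show "M \<otimes>\<^bsub>tensor_End S\<^esub> \<one>\<^bsub>tensor_End S\<^esub> = M"
    proof (intro ext)
      fix a b
      have "(M \<otimes>\<^bsub>tensor_End S\<^esub> \<one>\<^bsub>tensor_End S\<^esub>) a b = (\<Sum>c\<in>tensor_index S. if c = b then M a c else 0)"
        unfolding tensor_End_simps by (rule sum.cong) auto
      then show "(M \<otimes>\<^bsub>tensor_End S\<^esub> \<one>\<^bsub>tensor_End S\<^esub>) a b = M a b"
        using fin M[of a b] by (auto simp: sum.delta)
    qed
  qed (auto simp: tensor_End_simps)
qed

lemma on_factors_closed: "on_factors S A k l \<in> carrier (tensor_End S)"
  by (simp add: tensor_End_simps on_factors_def)

text \<open>Operators in the carrier vanish off the basis, and each basis index is an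
  \<open>index3\<close>, so these entries determine the operator.\<close>

lemma tensor_End3_eqI:
  assumes "M \<in> carrier (tensor_End {1..3})" "N \<in> carrier (tensor_End {1..3})"
    and eq: "\<And>x y z x' y' z'. M (index3 x y z) (index3 x' y' z') = N (index3 x y z) (index3 x' y' z')"
  shows "M = N"
proof (intro ext)
  fix a b
  show "M a b = N a b"
  proof (cases "a \<in> tensor_index {1..3} \<and> b \<in> tensor_index {1..3}")
    case True
    then show ?thesis
      using eq[of "a 1" "a 2" "a 3" "b 1" "b 2" "b 3"] by (simp only: tensor_index3_eq[symmetric])
  next
    case False
    then have "M a b = 0" "N a b = 0"
      using assms(1,2) unfolding tensor_End_simps by blast+
    then show ?thesis
      by simp
  qed
qed

lemma on_factors3:
  "on_factors {1..3} A 1 2 (index3 x y z) (index3 x' y' z') = (if z = z' then A $ (x, y) $ (x', y') else 0)"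
  "on_factors {1..3} A 2 3 (index3 x y z) (index3 x' y' z') = (if x = x' then A $ (y, z) $ (y', z') else 0)"
proof -
  have "{1..3} - {1, 2} = {3::nat}" "{1..3} - {2, 3} = {1::nat}"
    by auto
  then show "on_factors {1..3} A 1 2 (index3 x y z) (index3 x' y' z') = (if z = z' then A $ (x, y) $ (x', y') else 0)"
    "on_factors {1..3} A 2 3 (index3 x y z) (index3 x' y' z') = (if x = x' then A $ (y, z) $ (y', z') else 0)"
    unfolding on_factors_def by simp_all
qed

text \<open>Writing the unit as an operator on the first two factors lets it be matched with the
  outcome of \<open>on_factors3_mult\<close> when inverses are computed.\<close>

lemma one_tensor_End3: "\<one>\<^bsub>tensor_End {1..3}\<^esub> = on_factors {1..3} (mat 1) 1 2"
proof (rule tensor_End3_eqI)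
  have "index3 x y z = index3 x' y' z' \<longleftrightarrow> x = x' \<and> y = y' \<and> z = z'" for x y z x' y' z' :: 'a
    by (metis index3_simps)
  then show "\<one>\<^bsub>tensor_End {1..3}\<^esub> (index3 x y z) (index3 x' y' z') =
    on_factors {1..3} (mat 1) 1 2 (index3 x y z) (index3 x' y' z')" for x y z x' y' z' :: 'a
    unfolding on_factors3 by (simp add: tensor_End_simps mat_def)
qed (simp_all add: on_factors_closed, simp add: tensor_End_simps)

text \<open>The third factor is a spectator, so its index only contributes a delta. The entrywise
  form also serves to bring operator identities on three factors back down to matrices on
  two.\<close>

lemma on_factors3_mult_nth:
  "(on_factors {1..3} A 1 2 \<otimes>\<^bsub>tensor_End {1..3}\<^esub> on_factors {1..3} B 1 2) (index3 x y z) (index3 x' y' z') =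
    (if z = z' then (A ** B) $ (x, y) $ (x', y') else 0)"
proof -
  have "(on_factors {1..3} A 1 2 \<otimes>\<^bsub>tensor_End {1..3}\<^esub> on_factors {1..3} B 1 2) (index3 x y z) (index3 x' y' z') =
    (\<Sum>a\<in>UNIV. \<Sum>b\<in>UNIV. \<Sum>c\<in>UNIV. if c = z then if z = z' then A $ (x, y) $ (a, b) * B $ (a, b) $ (x', y') else 0 else 0)"
    unfolding tensor_End_simps sum_tensor_index3 on_factors3
    by (intro sum.cong refl) auto
  also have "\<dots> = (if z = z' then \<Sum>a\<in>UNIV. \<Sum>b\<in>UNIV. A $ (x, y) $ (a, b) * B $ (a, b) $ (x', y') else 0)"
    by (simp add: sum.delta)
  also have "\<dots> = (if z = z' then (A ** B) $ (x, y) $ (x', y') else 0)"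
    by (simp add: sum_pairs matrix_matrix_mult_def)
  finally show ?thesis .
qed

lemma on_factors3_mult:
  "on_factors {1..3} A 1 2 \<otimes>\<^bsub>tensor_End {1..3}\<^esub> on_factors {1..3} B 1 2 = on_factors {1..3} (A ** B) 1 2"
  by (rule tensor_End3_eqI) (simp_all add: on_factors_closed monoid.m_closed[OF monoid_tensor_End] on_factors3_mult_nth
      on_factors3 del: One_nat_def)

lemma inv_on_factors3:
  fixes A B :: "complex^('n::finite \<times> 'n)^('n \<times> 'n)"
  assumes "A ** B = mat 1" "B ** A = mat 1"
  shows "inv\<^bsub>tensor_End {1..3}\<^esub> (on_factors {1..3} A 1 2) = on_factors {1..3} B 1 2"
proof -
  interpret E: Group.monoid "tensor_End {1..3} :: (complex, 'n tensor_op) module"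
    by (rule monoid_tensor_End) simp
  show ?thesis
    by (rule E.inv_char) (simp_all only: on_factors_closed on_factors3_mult assms one_tensor_End3)
qed

text \<open>When \<open>K\<close> has rank one, the outer indices split off as \<open>gbar\<close>
  at \<open>(y, z)\<close> and \<open>g\<close> at \<open>(y', z')\<close>, and the remaining triple
  sum is an entry of the operator \<phi>(A) of the introduction.\<close>

lemma on_factors3_sandwich:
  "(on_factors {1..3} K 2 3 \<otimes>\<^bsub>tensor_End {1..3}\<^esub> on_factors {1..3} A 1 2 \<otimes>\<^bsub>tensor_End {1..3}\<^esub> on_factors {1..3} K 2 3)
      (index3 x y z) (index3 x' y' z') =
    (\<Sum>b'\<in>UNIV. \<Sum>c\<in>UNIV. \<Sum>b\<in>UNIV. K $ (y, z) $ (b, c) * A $ (x, b) $ (x', b') * K $ (b', c) $ (y', z'))"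
proof -
  have KA: "(on_factors {1..3} K 2 3 \<otimes>\<^bsub>tensor_End {1..3}\<^esub> on_factors {1..3} A 1 2) (index3 x y z) (index3 u v w) =
    (\<Sum>b\<in>UNIV. K $ (y, z) $ (b, w) * A $ (x, b) $ (u, v))" for u v w
  proof -
    have "(on_factors {1..3} K 2 3 \<otimes>\<^bsub>tensor_End {1..3}\<^esub> on_factors {1..3} A 1 2) (index3 x y z) (index3 u v w) =
      (\<Sum>a\<in>UNIV. \<Sum>b\<in>UNIV. \<Sum>c\<in>UNIV. if c = w then if a = x then K $ (y, z) $ (b, w) * A $ (x, b) $ (u, v) else 0 else 0)"
      unfolding tensor_End_simps sum_tensor_index3 on_factors3 by (intro sum.cong refl) auto
    also have "\<dots> = (\<Sum>a\<in>UNIV. if a = x then \<Sum>b\<in>UNIV. K $ (y, z) $ (b, w) * A $ (x, b) $ (u, v) else 0)"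
      by (intro sum.cong refl) (simp add: sum.delta)
    finally show ?thesis
      by (simp add: sum.delta)
  qed
  have "(on_factors {1..3} K 2 3 \<otimes>\<^bsub>tensor_End {1..3}\<^esub> on_factors {1..3} A 1 2 \<otimes>\<^bsub>tensor_End {1..3}\<^esub> on_factors {1..3} K 2 3)
      (index3 x y z) (index3 x' y' z') =
    (\<Sum>a\<in>UNIV. \<Sum>b'\<in>UNIV. \<Sum>c\<in>UNIV. if a = x' then
      (\<Sum>b\<in>UNIV. K $ (y, z) $ (b, c) * A $ (x, b) $ (x', b')) * K $ (b', c) $ (y', z') else 0)"
    unfolding tensor_End_simps(2)[where M = "on_factors {1..3} K 2 3 \<otimes>\<^bsub>tensor_End {1..3}\<^esub> on_factors {1..3} A 1 2"]
      sum_tensor_index3 on_factors3 KA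
    by (intro sum.cong refl) auto
  also have "\<dots> = (\<Sum>a\<in>UNIV. if a = x' then \<Sum>b'\<in>UNIV. \<Sum>c\<in>UNIV.
      (\<Sum>b\<in>UNIV. K $ (y, z) $ (b, c) * A $ (x, b) $ (x', b')) * K $ (b', c) $ (y', z') else 0)"
    by (intro sum.cong refl) simp
  finally show ?thesis
    by (simp add: sum.delta sum_distrib_right)
qed


section \<open>Consequences of the Birman-Murakami-Wenzl relations\<close>

lemma mat_mult_nth: "(mat c ** A) $ i $ j = c * A $ i $ j"
  for A :: "complex^'m^('m::finite)"
  by (simp add: matrix_matrix_mult_def mat_def if_distrib[of "\<lambda>x. x * _"] cong: if_cong)

lemma mult_mat_nth: "(A ** mat c) $ i $ j = A $ i $ j * c"
  for A :: "complex^'m^('m::finite)"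
  by (simp add: matrix_matrix_mult_def mat_def if_distrib[of "\<lambda>x. _ * x"] cong: if_cong)

text \<open>Expanding \<open>(q - R) (q\<^sup>-\<^sup>1 + R)\<close> gives
  \<open>1 + (q - q\<^sup>-\<^sup>1) R - R\<^sup>2\<close>. Read backwards, this is the quadratic
  relation of the BMW algebra.\<close>

lemma K_hat_nth:
  assumes "q \<noteq> 0"
  shows "K_hat q \<nu> R $ p $ r =
    inverse (q - inverse q) * inverse \<nu> * ((if p = r then 1 else 0) + (q - inverse q) * R $ p $ r - (R ** R) $ p $ r)"
proof -
  have "((mat q - R) ** (mat (inverse q) + R)) $ p $ r =
    (mat q ** mat (inverse q)) $ p $ r + (mat q ** R) $ p $ r - (R ** mat (inverse q)) $ p $ r - (R ** R) $ p $ r"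
    by (simp add: matrix_matrix_mult_def algebra_simps sum.distrib sum_subtractf)
  also have "\<dots> = (if p = r then 1 else 0) + (q - inverse q) * R $ p $ r - (R ** R) $ p $ r"
    unfolding mat_mult_nth mult_mat_nth using assms by (simp add: mat_def algebra_simps)
  finally show ?thesis
    by (simp add: K_hat_def mat_mult_nth flip: matrix_mul_assoc)
qed

text \<open>If \<open>K\<close> vanished, \<open>R\<close> would be annihilated by the quadratic
  polynomial \<open>1 + (q - q\<^sup>-\<^sup>1) x - x\<^sup>2\<close>, while its minimal polynomial
  has degree 3.\<close>

lemma K_hat_nonzero:
  assumes "q \<noteq> 0" "q - inverse q \<noteq> 0" "\<nu> \<noteq> 0" "is_minimal_polynomial p R" "degree p = 3"
  shows "\<exists>s t. K_hat q \<nu> R $ s $ t \<noteq> 0"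
proof (rule ccontr)
  let ?r = "[:1, q - inverse q, -1:]"
  assume "\<not> ?thesis"
  then have "K_hat q \<nu> R $ s $ t = 0" for s t
    by blast
  then have zero: "(if s = t then 1 else 0) + (q - inverse q) * R $ s $ t - (R ** R) $ s $ t = 0" for s t
    using assms(1-3) unfolding K_hat_nth[OF assms(1)] by simp
  have "poly_matrix ?r R = mat 1 ** mat 1 + mat (q - inverse q) ** R + mat (- 1) ** (R ** R)"
    by (simp add: poly_matrix_def numeral_2_eq_2 atMost_Suc algebra_simps)
  also have "\<dots> = 0"
    unfolding vec_eq_iff vector_add_component mat_mult_nth zero_index
    using zero by (simp add: mat_def del: split_paired_All)
  finally have "degree p \<le> degree ?r"
    using assms(4) unfolding is_minimal_polynomial_def by (metis pCons_eq_0_iff zero_neq_one)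
  then show False
    using assms(5) by simp
qed

text \<open>The map \<phi> is applied to both sides of
  \<open>R - R\<^sup>-\<^sup>1 = \<lambda> (1 - K)\<close>; three of the four values are known, and
  the fourth, \<phi>(K), comes out as the identity. The transpose reflects that the entry
  \<open>(i, j)\<close> of \<open>X\<close> is the entry \<open>(j, i)\<close> of
  \<open>g ** gbar\<close>.\<close>

lemma BMW_gbar_g_inverse:
  fixes R :: "complex^('n::finite \<times> 'n)^('n \<times> 'n)" and gbar g :: "complex^'n^'n"
  assumes q: "q \<notin> {0, 1, -1}" and \<nu>: "\<nu> \<noteq> 0" and bmw: "BMW_type q \<nu> R"
    and K: "\<forall>i j k l. K_hat q \<nu> R $ (i, j) $ (k, l) = gbar $ i $ j * g $ k $ l"
  shows "gbar ** g ** transpose (g ** gbar) = mat 1"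
proof -
  define lam where "lam = q - inverse q"
  let ?K = "K_hat q \<nu> R" and ?E = "tensor_End {1..3} :: (complex, 'n tensor_op) module"
  let ?\<delta> = "\<lambda>p r. if p = r then 1 else 0 :: complex"
  have "q \<noteq> 0"
    using q by simp
  have "lam \<noteq> 0"
  proof
    assume "lam = 0"
    then have "q * q = 1"
      using \<open>q \<noteq> 0\<close> by (simp add: lam_def field_simps)
    then show False
      using q by (simp add: square_eq_1_iff)
  qed
  obtain Q where RQ: "R ** Q = mat 1" and QR: "Q ** R = mat 1"
    using bmw by (auto simp: BMW_type_def R_matrix_def invertible_def)
  \<comment> \<open>Three strands are the fewest with two neighbouring generators, hence with the
    relations that sandwich \<open>e i\<close> between copies of
    \<open>\<kappa> (i + 1)\<close>.\<close>
  have rep: "BMW_representation ?E 3 q \<nu> (\<lambda>i. on_factors {1..3} R i (i + 1)) (\<lambda>i. on_factors {1..3} ?K i (i + 1))"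
    using bmw by (simp only: BMW_type_def)
  have rep1: "on_factors {1..3} R 1 2 \<otimes>\<^bsub>?E\<^esub> on_factors {1..3} ?K 1 2 = \<nu> \<odot>\<^bsub>?E\<^esub> on_factors {1..3} ?K 1 2"
  proof -
    have "\<forall>i\<in>{1..<3}. on_factors {1..3} R i (i + 1) \<otimes>\<^bsub>?E\<^esub> on_factors {1..3} ?K i (i + 1) = \<nu> \<odot>\<^bsub>?E\<^esub> on_factors {1..3} ?K i (i + 1)"
      using rep unfolding BMW_representation_def by blast
    from bspec[OF this, of 1] show ?thesis
      by (simp add: numeral_2_eq_2)
  qed
  have rep23: "on_factors {1..3} ?K 2 3 \<otimes>\<^bsub>?E\<^esub> on_factors {1..3} R 1 2 \<otimes>\<^bsub>?E\<^esub> on_factors {1..3} ?K 2 3 =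
      inverse \<nu> \<odot>\<^bsub>?E\<^esub> on_factors {1..3} ?K 2 3"
    "on_factors {1..3} ?K 2 3 \<otimes>\<^bsub>?E\<^esub> on_factors {1..3} Q 1 2 \<otimes>\<^bsub>?E\<^esub> on_factors {1..3} ?K 2 3 =
      \<nu> \<odot>\<^bsub>?E\<^esub> on_factors {1..3} ?K 2 3"
  proof -
    let ?R = "\<lambda>i. on_factors {1..3} R i (i + 1)" and ?L = "\<lambda>i. on_factors {1..3} ?K i (i + 1)"
    have "\<forall>i. 1 \<le> i \<and> i + 1 < 3 \<longrightarrow>
       ?L (i + 1) \<otimes>\<^bsub>?E\<^esub> ?R i \<otimes>\<^bsub>?E\<^esub> ?L (i + 1) = inverse \<nu> \<odot>\<^bsub>?E\<^esub> ?L (i + 1) \<and>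
       ?L (i + 1) \<otimes>\<^bsub>?E\<^esub> inv\<^bsub>?E\<^esub> (?R i) \<otimes>\<^bsub>?E\<^esub> ?L (i + 1) = \<nu> \<odot>\<^bsub>?E\<^esub> ?L (i + 1)"
      using rep unfolding BMW_representation_def by blast
    from spec[OF this, of 1] have "?L (1 + 1) \<otimes>\<^bsub>?E\<^esub> ?R 1 \<otimes>\<^bsub>?E\<^esub> ?L (1 + 1) = inverse \<nu> \<odot>\<^bsub>?E\<^esub> ?L (1 + 1)"
      "?L (1 + 1) \<otimes>\<^bsub>?E\<^esub> inv\<^bsub>?E\<^esub> (?R 1) \<otimes>\<^bsub>?E\<^esub> ?L (1 + 1) = \<nu> \<odot>\<^bsub>?E\<^esub> ?L (1 + 1)"
      by auto
    moreover have "1 + 1 = (2::nat)" "2 + 1 = (3::nat)"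
      by simp_all
    ultimately show "on_factors {1..3} ?K 2 3 \<otimes>\<^bsub>?E\<^esub> on_factors {1..3} R 1 2 \<otimes>\<^bsub>?E\<^esub> on_factors {1..3} ?K 2 3 =
      inverse \<nu> \<odot>\<^bsub>?E\<^esub> on_factors {1..3} ?K 2 3"
      "on_factors {1..3} ?K 2 3 \<otimes>\<^bsub>?E\<^esub> on_factors {1..3} Q 1 2 \<otimes>\<^bsub>?E\<^esub> on_factors {1..3} ?K 2 3 =
      \<nu> \<odot>\<^bsub>?E\<^esub> on_factors {1..3} ?K 2 3"
      by (simp_all only: inv_on_factors3[OF RQ QR])
  qed
  \<comment> \<open>The operator identity \<open>rep1\<close> is read off at equal indices in the
    third factor; any value does, here \<open>x\<close>.\<close>
  have RK: "(R ** ?K) $ p $ r = \<nu> * ?K $ p $ r" for p r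
  proof -
    obtain x y x' y' where pr: "p = (x, y)" "r = (x', y')"
      by (cases p, cases r) auto
    show ?thesis
      using on_factors3_mult_nth[of R ?K x y x x' y' x]
      unfolding rep1 pr tensor_End_simps on_factors3 by simp
  qed
  \<comment> \<open>This is the definition of \<open>K_hat\<close> solved for the square of
    \<open>R\<close>.\<close>
  have RR: "(R ** R) $ p $ r = ?\<delta> p r + lam * R $ p $ r - lam * \<nu> * ?K $ p $ r" for p r
  proof -
    have cancel: "lam * \<nu> * (inverse lam * inverse \<nu> * z) = z" for z
      using \<open>lam \<noteq> 0\<close> \<nu> by (simp add: field_simps)
    show ?thesis
      unfolding K_hat_nth[OF \<open>q \<noteq> 0\<close>] lam_def[symmetric] cancel by simp
  qed
  \<comment> \<open>The degree of the minimal polynomial provides this nonzero entry, by which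
    identities multiplied by \<open>K\<close> are divided later.\<close>
  obtain s t where st: "?K $ s $ t \<noteq> 0"
    using K_hat_nonzero[of q \<nu> _ R] \<open>q \<noteq> 0\<close> \<open>lam \<noteq> 0\<close> \<nu> bmw unfolding BMW_type_def lam_def by blast
  have Kst: "?K $ p $ r = gbar $ fst p $ snd p * g $ fst r $ snd r" for p r
    using K by (cases p, cases r) simp
  have QK: "(Q ** ?K) $ p $ r = inverse \<nu> * ?K $ p $ r" for p r
  proof -
    have "?K $ p $ r = (Q ** (R ** ?K)) $ p $ r"
      by (simp add: matrix_mul_assoc QR)
    also have "\<dots> = \<nu> * (Q ** ?K) $ p $ r"
      by (simp add: matrix_matrix_mult_def[of Q] RK sum_distrib_left mult.left_commute)
    finally show ?thesis
      using \<nu> by simp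
  qed
  \<comment> \<open>\<open>RR\<close> is multiplied from the left by the inverse \<open>Q\<close>;
    in the last term \<open>QK\<close> cancels the factor \<nu>.\<close>
  have diff: "R $ p $ r - Q $ p $ r = lam * (?\<delta> p r - ?K $ p $ r)" for p r
  proof -
    have "R $ p $ r = (Q ** (R ** R)) $ p $ r"
      by (simp add: matrix_mul_assoc QR)
    also have "\<dots> = (\<Sum>s\<in>UNIV. Q $ p $ s * ?\<delta> s r) + lam * (Q ** R) $ p $ r - lam * \<nu> * (Q ** ?K) $ p $ r"
      by (simp add: matrix_matrix_mult_def[of Q] RR algebra_simps sum.distrib sum_subtractf sum_distrib_left)
    also have "(\<Sum>s\<in>UNIV. Q $ p $ s * ?\<delta> s r) = Q $ p $ r"
      by (simp add: if_distrib cong: if_cong)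
    also have "lam * \<nu> * (Q ** ?K) $ p $ r = lam * ?K $ p $ r"
      using \<nu> by (simp add: QK)
    finally show ?thesis
      by (simp add: QR mat_def algebra_simps)
  qed
  \<comment> \<open>This full contraction is the constant \<mu>: rank one gives
    \<open>K\<^sup>2 = tr K\<close>, while expanding one factor as a polynomial in \<open>R\<close>
    and using \<open>R K = \<nu> K\<close> gives the value \<open>\<lambda>\<^sup>-\<^sup>1
    \<nu>\<^sup>-\<^sup>1 (q - \<nu>) (q\<^sup>-\<^sup>1 + \<nu>)\<close>, multiplied out.\<close>
  define tr where "tr = (\<Sum>b\<in>UNIV. \<Sum>c\<in>UNIV. g $ b $ c * gbar $ b $ c)"
  have tr: "tr = inverse lam * inverse \<nu> * (1 + lam * \<nu> - \<nu> * \<nu>)"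
  proof -
    have KK: "(?K ** ?K) $ s $ t = tr * ?K $ s $ t"
      unfolding tr_def sum_pairs by (simp add: matrix_matrix_mult_def Kst sum_distrib_left sum_distrib_right mult_ac)
    have "(?K ** ?K) $ s $ t = inverse lam * inverse \<nu> *
      ((\<Sum>p\<in>UNIV. ?\<delta> s p * ?K $ p $ t) + lam * (R ** ?K) $ s $ t - (R ** R ** ?K) $ s $ t)"
      by (simp add: matrix_matrix_mult_def[of ?K] matrix_matrix_mult_def[of R ?K] matrix_matrix_mult_def[of "R ** R" ?K]
          K_hat_nth[OF \<open>q \<noteq> 0\<close>, of _ _ s] lam_def[symmetric] algebra_simps sum.distrib sum_subtractf sum_distrib_left)
    also have "(\<Sum>p\<in>UNIV. ?\<delta> s p * ?K $ p $ t) = ?K $ s $ t"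
      by (simp add: if_distrib[of "\<lambda>x. x * _"] cong: if_cong)
    also have "(R ** R ** ?K) $ s $ t = \<nu> * \<nu> * ?K $ s $ t"
    proof -
      have "(R ** (R ** ?K)) $ s $ t = (\<Sum>p\<in>UNIV. R $ s $ p * (\<nu> * ?K $ p $ t))"
        by (simp add: matrix_matrix_mult_def[of R "R ** ?K"] RK)
      also have "\<dots> = \<nu> * (R ** ?K) $ s $ t"
        by (simp add: matrix_matrix_mult_def[of R ?K] sum_distrib_left mult.left_commute)
      finally show ?thesis
        by (simp add: matrix_mul_assoc[symmetric] RK)
    qed
    finally have "tr * ?K $ s $ t = inverse lam * inverse \<nu> * (1 + lam * \<nu> - \<nu> * \<nu>) * ?K $ s $ t"
      unfolding KK RK by (simp add: algebra_simps)
    then show ?thesis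
      using st by simp
  qed
  \<comment> \<open>What the sandwich \<open>K\<^sub>2 A\<^sub>1 K\<^sub>2\<close> leaves on the
    first factor. The argument is an arbitrary function of two pairs, so that the delta and linear
    combinations can be inserted directly.\<close>
  define \<phi> where "\<phi> A x x' = (\<Sum>b'\<in>UNIV. \<Sum>c\<in>UNIV. \<Sum>b\<in>UNIV. g $ b $ c * A (x, b) (x', b') * gbar $ b' $ c)"
    for A :: "'n \<times> 'n \<Rightarrow> 'n \<times> 'n \<Rightarrow> complex" and x x'
  have \<phi>_eq: "\<phi> (\<lambda>p r. A $ p $ r) x x' = c * ?\<delta> x x'"
    if "on_factors {1..3} ?K 2 3 \<otimes>\<^bsub>?E\<^esub> on_factors {1..3} A 1 2 \<otimes>\<^bsub>?E\<^esub> on_factors {1..3} ?K 2 3 = c \<odot>\<^bsub>?E\<^esub> on_factors {1..3} ?K 2 3"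
    for A c x x'
  proof -
    \<comment> \<open>Factors two and three are fixed at the nonzero entry \<open>(s, t)\<close> of
      \<open>K\<close>, while \<open>x\<close> and \<open>x'\<close> on the first factor stay
      free.\<close>
    have "\<phi> (\<lambda>p r. A $ p $ r) x x' * ?K $ s $ t = c * ?\<delta> x x' * ?K $ s $ t"
      using on_factors3_sandwich[of ?K A x "fst s" "snd s" x' "fst t" "snd t"]
      unfolding that tensor_End_simps on_factors3
      by (simp add: Kst \<phi>_def sum_distrib_left sum_distrib_right mult_ac split: if_splits)
    then show ?thesis
      using st by simp
  qed
  have \<phi>R: "\<phi> (\<lambda>p r. R $ p $ r) x x' = inverse \<nu> * ?\<delta> x x'" and \<phi>Q: "\<phi> (\<lambda>p r. Q $ p $ r) x x' = \<nu> * ?\<delta> x x'" for x x'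
    using \<phi>_eq rep23 by blast+
  have \<phi>\<delta>: "\<phi> ?\<delta> x x' = tr * ?\<delta> x x'" for x x'
  proof -
    have "\<phi> ?\<delta> x x' = (\<Sum>b'\<in>UNIV. \<Sum>c\<in>UNIV. \<Sum>b\<in>UNIV. if b = b' then ?\<delta> x x' * (g $ b' $ c * gbar $ b' $ c) else 0)"
      unfolding \<phi>_def by (intro sum.cong refl) auto
    then show ?thesis
      by (simp add: tr_def sum_distrib_left mult.commute)
  qed
  \<comment> \<open>Here the middle \<open>K\<close> splits as well, and the four factors regroup as
    \<open>gbar ** g\<close> times the transpose of \<open>g ** gbar\<close>.\<close>
  have \<phi>K: "\<phi> (\<lambda>p r. ?K $ p $ r) x x' = (gbar ** g ** transpose (g ** gbar)) $ x $ x'" for x x'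
  proof -
    have "(gbar ** g ** transpose (g ** gbar)) $ x $ x' =
      (\<Sum>c\<in>UNIV. (\<Sum>b\<in>UNIV. gbar $ x $ b * g $ b $ c) * (\<Sum>b'\<in>UNIV. g $ x' $ b' * gbar $ b' $ c))"
      by (simp add: matrix_matrix_mult_def transpose_def)
    also have "\<dots> = (\<Sum>c\<in>UNIV. \<Sum>b'\<in>UNIV. \<Sum>b\<in>UNIV. g $ b $ c * ?K $ (x, b) $ (x', b') * gbar $ b' $ c)"
      by (simp add: sum_product K mult_ac) (rule sum.cong[OF refl], rule sum.swap)
    also have "\<dots> = \<phi> (\<lambda>p r. ?K $ p $ r) x x'"
      unfolding \<phi>_def by (rule sum.swap)
    finally show ?thesis ..
  qed
  have "\<phi> (\<lambda>p r. R $ p $ r) x x' - \<phi> (\<lambda>p r. Q $ p $ r) x x' = lam * (\<phi> ?\<delta> x x' - \<phi> (\<lambda>p r. ?K $ p $ r) x x')" for x x'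
  proof -
    have "\<phi> (\<lambda>p r. R $ p $ r) x x' - \<phi> (\<lambda>p r. Q $ p $ r) x x' = \<phi> (\<lambda>p r. R $ p $ r - Q $ p $ r) x x'"
      by (simp add: \<phi>_def algebra_simps sum_subtractf)
    also have "\<dots> = \<phi> (\<lambda>p r. lam * (?\<delta> p r - ?K $ p $ r)) x x'"
      by (simp only: diff)
    also have "\<dots> = lam * (\<phi> ?\<delta> x x' - \<phi> (\<lambda>p r. ?K $ p $ r) x x')"
      unfolding \<phi>_def sum_distrib_left sum_subtractf[symmetric] by (intro sum.cong refl) (simp add: algebra_simps)
    finally show ?thesis .
  qed
  then have "(inverse \<nu> - \<nu>) * ?\<delta> x x' = lam * (tr * ?\<delta> x x' - (gbar ** g ** transpose (g ** gbar)) $ x $ x')" for x x'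
    unfolding \<phi>R \<phi>Q \<phi>\<delta> \<phi>K by (simp add: left_diff_distrib)
  \<comment> \<open>With this value the terms in \<nu> on the two sides cancel, leaving \<lambda>
    \<phi>(K) = \<lambda>.\<close>
  moreover have "lam * tr = inverse \<nu> + lam - \<nu>"
    using \<open>lam \<noteq> 0\<close> \<nu> by (simp add: tr field_simps)
  ultimately have "lam * (gbar ** g ** transpose (g ** gbar)) $ x $ x' =
      (inverse \<nu> + lam - \<nu>) * ?\<delta> x x' - (inverse \<nu> - \<nu>) * ?\<delta> x x'" for x x'
    by (simp add: right_diff_distrib flip: mult.assoc)
  then have "lam * (gbar ** g ** transpose (g ** gbar)) $ x $ x' = lam * ?\<delta> x x'" for x x'
    by simp
  then show ?thesis
    using \<open>lam \<noteq> 0\<close> by (simp add: vec_eq_iff mat_def)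
qed

section \<open>Sums and intertwiners in complex algebras\<close>

text \<open>Only additivity is asked of \<open>h\<close>, so that one lemma serves algebra
  homomorphisms, scaling, multiplication by a fixed element and pure tensors with one slot
  fixed.\<close>

lemma finsum_additive:
  assumes "abelian_group A" "abelian_group B"
    and h: "\<And>x. x \<in> carrier A \<Longrightarrow> h x \<in> carrier B"
    and add: "\<And>x y. x \<in> carrier A \<Longrightarrow> y \<in> carrier A \<Longrightarrow> h (x \<oplus>\<^bsub>A\<^esub> y) = h x \<oplus>\<^bsub>B\<^esub> h y"
    and f: "\<And>i. i \<in> S \<Longrightarrow> f i \<in> carrier A"
  shows "h (\<Oplus>\<^bsub>A\<^esub>i\<in>S. f i) = (\<Oplus>\<^bsub>B\<^esub>i\<in>S. h (f i))"
proof -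
  interpret A: abelian_group A by fact
  interpret B: abelian_group B by fact
  \<comment> \<open>This covers the empty sum and also infinite \<open>S\<close>, where
    \<open>finsum\<close> defaults to zero on both sides.\<close>
  have zero: "h \<zero>\<^bsub>A\<^esub> = \<zero>\<^bsub>B\<^esub>"
    using add[of "\<zero>\<^bsub>A\<^esub>" "\<zero>\<^bsub>A\<^esub>"] h[OF A.zero_closed]
    by (metis A.l_zero A.zero_closed B.add.l_cancel_one)
  show ?thesis
    using f
  proof (induction S rule: infinite_finite_induct)
    case (insert i S)
    have "(\<Oplus>\<^bsub>A\<^esub>i\<in>S. f i) \<in> carrier A"
      using insert.prems by (intro A.finsum_closed) auto
    then show ?case
      using insert by (simp add: Pi_def h add A.finsum_insert B.finsum_insert)
  qed (simp_all add: zero)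
qed

context abelian_group
begin

lemma finsum_Times:
  assumes "finite S" "finite T"
    and "\<And>i j. i \<in> S \<Longrightarrow> j \<in> T \<Longrightarrow> f i j \<in> carrier G"
  shows "(\<Oplus>i\<in>S. \<Oplus>j\<in>T. f i j) = (\<Oplus>p\<in>S \<times> T. f (fst p) (snd p))"
  using assms(1,3)
proof (induction S)
  case (insert i S)
  have "(\<Oplus>p\<in>insert i S \<times> T. f (fst p) (snd p)) = (\<Oplus>p\<in>Pair i ` T \<union> S \<times> T. f (fst p) (snd p))"
    by (rule arg_cong[of _ _ "finsum G _"]) auto
  also have "\<dots> = (\<Oplus>p\<in>Pair i ` T. f (fst p) (snd p)) \<oplus> (\<Oplus>p\<in>S \<times> T. f (fst p) (snd p))"
    using insert assms(2) by (intro finsum_Un_disjoint) auto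
  also have "(\<Oplus>p\<in>Pair i ` T. f (fst p) (snd p)) = (\<Oplus>j\<in>T. f i j)"
    using insert.prems by (subst finsum_reindex) (auto simp: inj_on_def)
  finally show ?case
    using insert by (simp add: Pi_def finsum_insert)
qed simp

lemma finsum_pairs:
  fixes f :: "'i::finite \<Rightarrow> 'j::finite \<Rightarrow> 'a"
  assumes "\<And>i j. f i j \<in> carrier G"
  shows "(\<Oplus>i\<in>UNIV. \<Oplus>j\<in>UNIV. f i j) = (\<Oplus>p\<in>UNIV. f (fst p) (snd p))"
  using finsum_Times[of UNIV UNIV f] assms by simp

lemma finsum_swap:
  fixes f :: "'i::finite \<Rightarrow> 'j::finite \<Rightarrow> 'a"
  assumes "\<And>i j. f i j \<in> carrier G"
  shows "(\<Oplus>i\<in>UNIV. \<Oplus>j\<in>UNIV. f i j) = (\<Oplus>j\<in>UNIV. \<Oplus>i\<in>UNIV. f i j)"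
proof -
  have "(\<Oplus>i\<in>UNIV. \<Oplus>j\<in>UNIV. f i j) = (\<Oplus>p\<in>prod.swap ` UNIV. f (fst p) (snd p))"
    by (simp add: finsum_pairs assms surj_swap)
  also have "\<dots> = (\<Oplus>p\<in>UNIV. f (snd p) (fst p))"
    using assms by (subst finsum_reindex) (auto simp: Pi_def)
  also have "\<dots> = (\<Oplus>j\<in>UNIV. \<Oplus>i\<in>UNIV. f i j)"
    by (rule finsum_pairs[symmetric]) (rule assms)
  finally show ?thesis .
qed

lemma finsum_eqI:
  assumes "\<And>i. g i \<in> carrier G" "\<And>i. f i = g i"
  shows "(\<Oplus>i\<in>S. f i) = (\<Oplus>i\<in>S. g i)"
  using assms by (intro finsum_cong') auto

end

text \<open>The record type carries operations without laws; these are the laws of a unital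
  associative algebra. Scalars range over the whole type \<open>complex\<close>, so they bring no
  carrier conditions.\<close>

locale complex_alg = ring A for A :: "(complex, 'a) module" (structure) +
  assumes smult_closed [simp]: "x \<in> carrier A \<Longrightarrow> c \<odot> x \<in> carrier A"
    and smult_r_distr: "x \<in> carrier A \<Longrightarrow> y \<in> carrier A \<Longrightarrow> c \<odot> (x \<oplus> y) = c \<odot> x \<oplus> c \<odot> y"
    and smult_l_distr: "x \<in> carrier A \<Longrightarrow> (c + d) \<odot> x = c \<odot> x \<oplus> d \<odot> x"
    and smult_smult: "x \<in> carrier A \<Longrightarrow> c \<odot> (d \<odot> x) = (c * d) \<odot> x"
    and smult_one [simp]: "x \<in> carrier A \<Longrightarrow> 1 \<odot> x = x"
    and mult_smult_left: "x \<in> carrier A \<Longrightarrow> y \<in> carrier A \<Longrightarrow> (c \<odot> x) \<otimes> y = c \<odot> (x \<otimes> y)"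
    and mult_smult_right: "x \<in> carrier A \<Longrightarrow> y \<in> carrier A \<Longrightarrow> x \<otimes> (c \<odot> y) = c \<odot> (x \<otimes> y)"
begin

lemma smult_zero_left [simp]:
  assumes "x \<in> carrier A" shows "0 \<odot> x = \<zero>"
  using smult_l_distr[OF assms, of 0 0] assms by simp

lemma smult_cancel:
  assumes "c \<noteq> 0" "x \<in> carrier A" "y \<in> carrier A" "c \<odot> x = c \<odot> y"
  shows "x = y"
proof -
  have "inverse c \<odot> (c \<odot> x) = inverse c \<odot> (c \<odot> y)"
    using assms by simp
  then show ?thesis
    using assms(1-3) by (simp add: smult_smult)
qed

lemma finsum_closed_total [simp]: "(\<And>i. f i \<in> carrier A) \<Longrightarrow> (\<Oplus>i\<in>S. f i) \<in> carrier A"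
  by (rule finsum_closed) auto

lemma smult_finsum:
  assumes "\<And>i. f i \<in> carrier A"
  shows "c \<odot> (\<Oplus>i\<in>S. f i) = (\<Oplus>i\<in>S. c \<odot> f i)"
  by (rule finsum_additive) (auto simp: assms smult_r_distr abelian_group_axioms)

lemma mult_finsum_left:
  assumes "\<And>i. f i \<in> carrier A" "x \<in> carrier A"
  shows "(\<Oplus>i\<in>S. f i) \<otimes> x = (\<Oplus>i\<in>S. f i \<otimes> x)"
  using finsum_additive[where h = "\<lambda>y. y \<otimes> x" and A = A and B = A and f = f and S = S]
  by (auto simp: assms l_distr abelian_group_axioms)

lemma mult_finsum_right:
  assumes "\<And>i. f i \<in> carrier A" "x \<in> carrier A"
  shows "x \<otimes> (\<Oplus>i\<in>S. f i) = (\<Oplus>i\<in>S. x \<otimes> f i)"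
  by (rule finsum_additive) (auto simp: assms r_distr abelian_group_axioms)

lemma sum_smult:
  assumes "finite S" "x \<in> carrier A"
  shows "(\<Sum>i\<in>S. c i) \<odot> x = (\<Oplus>i\<in>S. c i \<odot> x)"
  using assms(1) by induction (auto simp: assms smult_l_distr finsum_insert)

lemma finsum_delta:
  fixes i :: "'i::finite"
  assumes "\<And>i. f i \<in> carrier A"
  shows "(\<Oplus>j\<in>UNIV. (if i = j then c else 0) \<odot> f j) = c \<odot> f i"
    "(\<Oplus>j\<in>UNIV. (if j = i then c else 0) \<odot> f j) = c \<odot> f i"
proof -
  have "(\<Oplus>j\<in>UNIV. (if i = j then c else 0) \<odot> f j) = (\<Oplus>j\<in>UNIV. if i = j then c \<odot> f j else \<zero>)"
    by (rule finsum_eqI) (auto simp: assms)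
  also have "\<dots> = c \<odot> f i"
    using add.finprod_singleton[of i UNIV "\<lambda>i. c \<odot> f i"] by (simp add: assms Pi_def)
  finally show "(\<Oplus>j\<in>UNIV. (if i = j then c else 0) \<odot> f j) = c \<odot> f i" .
  then show "(\<Oplus>j\<in>UNIV. (if j = i then c else 0) \<odot> f j) = c \<odot> f i"
    by (simp only: eq_commute)
qed

text \<open>Both identities exchange two finite sums: the family \<open>f\<close> is treated as a
  column vector in the first and as a row vector in the second.\<close>

lemma finsum_smult_matrix_mult:
  fixes M N :: "complex^'m^('m::finite)"
  assumes "\<And>r. f r \<in> carrier A"
  shows "(\<Oplus>r\<in>UNIV. (M ** N) $ p $ r \<odot> f r) = (\<Oplus>s\<in>UNIV. M $ p $ s \<odot> (\<Oplus>r\<in>UNIV. N $ s $ r \<odot> f r))"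
    "(\<Oplus>r\<in>UNIV. (M ** N) $ r $ p \<odot> f r) = (\<Oplus>s\<in>UNIV. N $ s $ p \<odot> (\<Oplus>r\<in>UNIV. M $ r $ s \<odot> f r))"
proof -
  have "(\<Oplus>r\<in>UNIV. (M ** N) $ p $ r \<odot> f r) = (\<Oplus>r\<in>UNIV. \<Oplus>s\<in>UNIV. M $ p $ s \<odot> (N $ s $ r \<odot> f r))"
    by (rule finsum_eqI) (auto simp: assms matrix_matrix_mult_def sum_smult smult_smult)
  also have "\<dots> = (\<Oplus>s\<in>UNIV. M $ p $ s \<odot> (\<Oplus>r\<in>UNIV. N $ s $ r \<odot> f r))"
    by (subst finsum_swap) (simp_all add: assms smult_finsum)
  finally show "(\<Oplus>r\<in>UNIV. (M ** N) $ p $ r \<odot> f r) = \<dots>" .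
  have "(\<Oplus>r\<in>UNIV. (M ** N) $ r $ p \<odot> f r) = (\<Oplus>r\<in>UNIV. \<Oplus>s\<in>UNIV. N $ s $ p \<odot> (M $ r $ s \<odot> f r))"
    by (rule finsum_eqI) (auto simp: assms matrix_matrix_mult_def sum_smult smult_smult mult.commute)
  also have "\<dots> = (\<Oplus>s\<in>UNIV. N $ s $ p \<odot> (\<Oplus>r\<in>UNIV. M $ r $ s \<odot> f r))"
    by (subst finsum_swap) (simp_all add: assms smult_finsum)
  finally show "(\<Oplus>r\<in>UNIV. (M ** N) $ r $ p \<odot> f r) = \<dots>" .
qed

text \<open>The commutation \<open>M W = W M\<close> of a scalar matrix with a matrix over the
  algebra. For \<open>M = R\<close> and \<open>W = T\<^sub>1 T\<^sub>2\<close> it is the defining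
  relation of the bialgebra.\<close>

definition intertwines :: "complex^'m^('m::finite) \<Rightarrow> ('m \<Rightarrow> 'm \<Rightarrow> 'a) \<Rightarrow> bool" where
  "intertwines M W \<longleftrightarrow>
    (\<forall>p q. (\<Oplus>r\<in>UNIV. M $ p $ r \<odot> W r q) = (\<Oplus>r\<in>UNIV. M $ r $ q \<odot> W p r))"

text \<open>Together with the two closure lemmas that follow: the scalar matrices commuting with
  \<open>W\<close> form an algebra containing the constants, hence all polynomials in any
  member.\<close>

lemma intertwines_mat:
  assumes "\<And>p q. W p q \<in> carrier A"
  shows "intertwines (mat c) W"
  by (simp add: intertwines_def mat_def finsum_delta assms)

lemma intertwines_add:
  assumes "\<And>p q. W p q \<in> carrier A" "intertwines M W" "intertwines N W"
  shows "intertwines (M + N) W"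
  using assms by (simp add: intertwines_def smult_l_distr finsum_addf Pi_def)

lemma intertwines_mult:
  assumes W: "\<And>p q. W p q \<in> carrier A" and M: "intertwines M W" and N: "intertwines N W"
  shows "intertwines (M ** N) W"
  unfolding intertwines_def
proof (intro allI)
  fix p q
  have "(\<Oplus>r\<in>UNIV. (M ** N) $ p $ r \<odot> W r q) = (\<Oplus>s\<in>UNIV. M $ p $ s \<odot> (\<Oplus>r\<in>UNIV. N $ r $ q \<odot> W s r))"
    using N by (simp add: finsum_smult_matrix_mult W intertwines_def)
  also have "\<dots> = (\<Oplus>r\<in>UNIV. N $ r $ q \<odot> (\<Oplus>s\<in>UNIV. M $ p $ s \<odot> W s r))"
    by (simp add: smult_finsum W smult_smult mult.commute) (subst finsum_swap, simp_all add: W)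
  also have "\<dots> = (\<Oplus>r\<in>UNIV. (M ** N) $ r $ q \<odot> W p r)"
    using M by (simp add: finsum_smult_matrix_mult W intertwines_def)
  finally show "(\<Oplus>r\<in>UNIV. (M ** N) $ p $ r \<odot> W r q) = (\<Oplus>r\<in>UNIV. (M ** N) $ r $ q \<odot> W p r)" .
qed

end

lemma algebra_homD:
  assumes "h \<in> algebra_hom A B"
  shows "x \<in> carrier A \<Longrightarrow> h x \<in> carrier B"
    "x \<in> carrier A \<Longrightarrow> y \<in> carrier A \<Longrightarrow> h (x \<otimes>\<^bsub>A\<^esub> y) = h x \<otimes>\<^bsub>B\<^esub> h y"
    "x \<in> carrier A \<Longrightarrow> y \<in> carrier A \<Longrightarrow> h (x \<oplus>\<^bsub>A\<^esub> y) = h x \<oplus>\<^bsub>B\<^esub> h y"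
    "h \<one>\<^bsub>A\<^esub> = \<one>\<^bsub>B\<^esub>"
    "x \<in> carrier A \<Longrightarrow> h (c \<odot>\<^bsub>A\<^esub> x) = c \<odot>\<^bsub>B\<^esub> h x"
  using assms by (auto simp: algebra_hom_def dest: ring_hom_closed ring_hom_mult ring_hom_add ring_hom_one)

lemma algebra_homI:
  assumes "\<And>x. x \<in> carrier A \<Longrightarrow> h x \<in> carrier B"
    "\<And>x y. x \<in> carrier A \<Longrightarrow> y \<in> carrier A \<Longrightarrow> h (x \<otimes>\<^bsub>A\<^esub> y) = h x \<otimes>\<^bsub>B\<^esub> h y"
    "\<And>x y. x \<in> carrier A \<Longrightarrow> y \<in> carrier A \<Longrightarrow> h (x \<oplus>\<^bsub>A\<^esub> y) = h x \<oplus>\<^bsub>B\<^esub> h y"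
    "h \<one>\<^bsub>A\<^esub> = \<one>\<^bsub>B\<^esub>"
    "\<And>c x. x \<in> carrier A \<Longrightarrow> h (c \<odot>\<^bsub>A\<^esub> x) = c \<odot>\<^bsub>B\<^esub> h x"
  shows "h \<in> algebra_hom A B"
  using assms by (auto simp: algebra_hom_def intro: ring_hom_memI)

lemma algebra_hom_comp:
  "g \<in> algebra_hom A B \<Longrightarrow> h \<in> algebra_hom B C \<Longrightarrow> (\<lambda>x. h (g x)) \<in> algebra_hom A C"
  by (rule algebra_homI) (simp_all add: algebra_homD)

lemma algebra_hom_finsum:
  assumes "complex_alg A" "complex_alg B" "h \<in> algebra_hom A B" "\<And>i. f i \<in> carrier A"
  shows "h (\<Oplus>\<^bsub>A\<^esub>i\<in>S. f i) = (\<Oplus>\<^bsub>B\<^esub>i\<in>S. h (f i))"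
proof -
  interpret A: complex_alg A by fact
  interpret B: complex_alg B by fact
  show ?thesis
    by (rule finsum_additive)
      (auto simp: assms algebra_homD[OF assms(3)] A.abelian_group_axioms B.abelian_group_axioms)
qed

lemma algebra_hom_lincomb:
  assumes "complex_alg A" "complex_alg B" "h \<in> algebra_hom A B" "\<And>i. f i \<in> carrier A"
  shows "h (\<Oplus>\<^bsub>A\<^esub>i\<in>S. c i \<odot>\<^bsub>A\<^esub> f i) = (\<Oplus>\<^bsub>B\<^esub>i\<in>S. c i \<odot>\<^bsub>B\<^esub> h (f i))"
  using algebra_hom_finsum[OF assms(1-3), of "\<lambda>i. c i \<odot>\<^bsub>A\<^esub> f i"] assms
  by (simp add: complex_alg.smult_closed algebra_homD(5)[OF assms(3)])


section \<open>Monoid algebras\<close>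

lemma monoid_algebra_simps:
  "carrier (monoid_algebra M) = {p. Poly_Mapping.keys p \<subseteq> carrier M}"
  "\<one>\<^bsub>monoid_algebra M\<^esub> = Poly_Mapping.single \<one>\<^bsub>M\<^esub> 1"
  "\<zero>\<^bsub>monoid_algebra M\<^esub> = 0"
  "p \<oplus>\<^bsub>monoid_algebra M\<^esub> r = p + r"
  "c \<odot>\<^bsub>monoid_algebra M\<^esub> p = Poly_Mapping.map ((*) c) p"
  by (simp_all add: monoid_algebra_def)

lemma poly_mapping_sum_single: "p = (\<Sum>x\<in>Poly_Mapping.keys p. Poly_Mapping.single x (Poly_Mapping.lookup p x))"
  by (rule poly_mapping_eqI)
    (simp add: lookup_sum lookup_single when_def sum.If_cases in_keys_iff flip: Int_def)

text \<open>A finitely supported function is the finite sum of its one-point parts. Keeping all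
  supports inside \<open>C\<close> makes carrier assumptions available in the induction
  steps.\<close>

lemma poly_mapping_single_induct [consumes 1, case_names zero single add]:
  fixes p :: "'a \<Rightarrow>\<^sub>0 'b::comm_monoid_add"
  assumes "Poly_Mapping.keys p \<subseteq> C"
    and "P 0" "\<And>x c. x \<in> C \<Longrightarrow> P (Poly_Mapping.single x c)" 
    "\<And>p r. Poly_Mapping.keys p \<subseteq> C \<Longrightarrow> Poly_Mapping.keys r \<subseteq> C \<Longrightarrow> P p \<Longrightarrow> P r \<Longrightarrow> P (p + r)"
  shows "P p"
proof -
  let ?f = "\<lambda>x. Poly_Mapping.single x (Poly_Mapping.lookup p x)"
  \<comment> \<open>The support bound is carried along with \<open>P\<close>, because the rule for
    sums demands it of the partial sums.\<close>
  have "Poly_Mapping.keys (sum ?f S) \<subseteq> C \<and> P (sum ?f S)" if "finite S" "S \<subseteq> C" for S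
    using that
  proof induction
    case (insert x S)
    then show ?case
      using keys_add[of "?f x" "sum ?f S"] assms(4)[of "?f x" "sum ?f S"] assms(3)
      by (auto split: if_splits)
  qed (simp add: assms)
  from this[OF finite_keys assms(1)] show ?thesis
    by (simp flip: poly_mapping_sum_single)
qed

lemma lookup_map_scale: "Poly_Mapping.lookup (Poly_Mapping.map ((*) c) p) x = c * Poly_Mapping.lookup p x"
  for c :: complex
  by (simp add: Poly_Mapping.map.rep_eq when_def)

lemma
  fixes p :: "'a \<Rightarrow>\<^sub>0 complex"
  shows map_scale_add: "Poly_Mapping.map ((*) c) (p + r) = Poly_Mapping.map ((*) c) p + Poly_Mapping.map ((*) c) r"
    and map_scale_add_left: "Poly_Mapping.map ((*) (c + d)) p = Poly_Mapping.map ((*) c) p + Poly_Mapping.map ((*) d) p"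
    and map_scale_scale: "Poly_Mapping.map ((*) c) (Poly_Mapping.map ((*) d) p) = Poly_Mapping.map ((*) (c * d)) p"
    and map_scale_one: "Poly_Mapping.map ((*) 1) p = p"
    and map_scale_zero: "Poly_Mapping.map ((*) c) (0 :: 'a \<Rightarrow>\<^sub>0 complex) = 0"
  by (rule poly_mapping_eqI; simp add: lookup_map_scale lookup_add algebra_simps)+

lemma map_scale_single: "Poly_Mapping.map ((*) c) (Poly_Mapping.single x d) = Poly_Mapping.single x (c * d)"
  for c :: complex
  by simp

lemma keys_map_scale: "Poly_Mapping.keys (Poly_Mapping.map ((*) c) p) \<subseteq> Poly_Mapping.keys p"
  for c :: complex
  by (auto simp: in_keys_iff Poly_Mapping.map.rep_eq when_def split: if_splits)

text \<open>Indices outside the supports contribute zero. Common larger index sets are what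
  distributivity needs, since the support of a sum may shrink by cancellation.\<close>

lemma monoid_algebra_mult_eq:
  assumes "finite S" "finite T" "Poly_Mapping.keys p \<subseteq> S" "Poly_Mapping.keys r \<subseteq> T"
  shows "p \<otimes>\<^bsub>monoid_algebra M\<^esub> r = (\<Sum>x\<in>S. \<Sum>y\<in>T.
    Poly_Mapping.single (x \<otimes>\<^bsub>M\<^esub> y) (Poly_Mapping.lookup p x * Poly_Mapping.lookup r y))"
proof -
  have "p \<otimes>\<^bsub>monoid_algebra M\<^esub> r = (\<Sum>x\<in>Poly_Mapping.keys p. \<Sum>y\<in>T.
    Poly_Mapping.single (x \<otimes>\<^bsub>M\<^esub> y) (Poly_Mapping.lookup p x * Poly_Mapping.lookup r y))"
    unfolding monoid_algebra_def using assms
    by (simp, intro sum.cong[OF refl], intro sum.mono_neutral_left) (auto simp: in_keys_iff)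
  also have "\<dots> = (\<Sum>x\<in>S. \<Sum>y\<in>T.
    Poly_Mapping.single (x \<otimes>\<^bsub>M\<^esub> y) (Poly_Mapping.lookup p x * Poly_Mapping.lookup r y))"
    using assms by (intro sum.mono_neutral_left) (auto simp: in_keys_iff)
  finally show ?thesis .
qed

lemma monoid_algebra_l_distr:
  "(p + p') \<otimes>\<^bsub>monoid_algebra M\<^esub> r = p \<otimes>\<^bsub>monoid_algebra M\<^esub> r + p' \<otimes>\<^bsub>monoid_algebra M\<^esub> r"
  using keys_add[of p p']
  by (simp add: monoid_algebra_mult_eq[of "Poly_Mapping.keys p \<union> Poly_Mapping.keys p'" "Poly_Mapping.keys r"]
      lookup_add distrib_right single_add sum.distrib)

lemma monoid_algebra_r_distr:
  "r \<otimes>\<^bsub>monoid_algebra M\<^esub> (p + p') = r \<otimes>\<^bsub>monoid_algebra M\<^esub> p + r \<otimes>\<^bsub>monoid_algebra M\<^esub> p'"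
  using keys_add[of p p']
  by (simp add: monoid_algebra_mult_eq[of "Poly_Mapping.keys r" "Poly_Mapping.keys p \<union> Poly_Mapping.keys p'"]
      lookup_add distrib_left single_add sum.distrib)

lemma monoid_algebra_mult_zero:
  "0 \<otimes>\<^bsub>monoid_algebra M\<^esub> r = 0" "r \<otimes>\<^bsub>monoid_algebra M\<^esub> 0 = 0"
  by (simp_all add: monoid_algebra_def)

lemma monoid_algebra_mult_single:
  "Poly_Mapping.single x c \<otimes>\<^bsub>monoid_algebra M\<^esub> Poly_Mapping.single y d = Poly_Mapping.single (x \<otimes>\<^bsub>M\<^esub> y) (c * d)"
  by (simp add: monoid_algebra_mult_eq[of "{x}" "{y}"])

lemmas monoid_algebra_mult =
  monoid_algebra_l_distr monoid_algebra_r_distr monoid_algebra_mult_zero monoid_algebra_mult_single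

lemma monoid_algebra_mult_closed:
  assumes "Group.monoid M" "Poly_Mapping.keys p \<subseteq> carrier M" "Poly_Mapping.keys r \<subseteq> carrier M"
  shows "Poly_Mapping.keys (p \<otimes>\<^bsub>monoid_algebra M\<^esub> r) \<subseteq> carrier M"
  using assms(2)
proof (induction rule: poly_mapping_single_induct)
  case (single x c)
  show ?case
    using assms(3)
  proof (induction rule: poly_mapping_single_induct)
    case (single y d)
    then show ?case
      using \<open>x \<in> carrier M\<close> assms(1) by (simp add: monoid_algebra_mult monoid.m_closed)
  next
    case (add p r)
    then show ?case
      using keys_add by (force simp: monoid_algebra_mult)
  qed (simp add: monoid_algebra_mult)
next
  case (add p r)
  then show ?case
    using keys_add by (force simp: monoid_algebra_mult)
qed (simp add: monoid_algebra_mult)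

lemma monoid_algebra_assoc:
  assumes "Group.monoid M"
    "Poly_Mapping.keys p \<subseteq> carrier M" "Poly_Mapping.keys r \<subseteq> carrier M" "Poly_Mapping.keys s \<subseteq> carrier M"
  shows "p \<otimes>\<^bsub>monoid_algebra M\<^esub> r \<otimes>\<^bsub>monoid_algebra M\<^esub> s = p \<otimes>\<^bsub>monoid_algebra M\<^esub> (r \<otimes>\<^bsub>monoid_algebra M\<^esub> s)"
  using assms(2)
proof (induction rule: poly_mapping_single_induct)
  case (single x c)
  show ?case
    using assms(3)
  proof (induction rule: poly_mapping_single_induct)
    case (single y d)
    show ?case
      using assms(4)
    proof (induction rule: poly_mapping_single_induct)
      case (single z e)
      then show ?case
        using \<open>x \<in> carrier M\<close> \<open>y \<in> carrier M\<close> assms(1) by (simp add: monoid_algebra_mult monoid.m_assoc mult.assoc)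
    qed (simp_all add: monoid_algebra_mult)
  qed (simp_all add: monoid_algebra_mult)
qed (simp_all add: monoid_algebra_mult)

lemma monoid_algebra_mult_one:
  assumes "Group.monoid M" "Poly_Mapping.keys p \<subseteq> carrier M"
  shows "Poly_Mapping.single \<one>\<^bsub>M\<^esub> 1 \<otimes>\<^bsub>monoid_algebra M\<^esub> p = p"
    "p \<otimes>\<^bsub>monoid_algebra M\<^esub> Poly_Mapping.single \<one>\<^bsub>M\<^esub> 1 = p"
  using assms(2)
  by (induction rule: poly_mapping_single_induct)
    (simp_all add: monoid_algebra_mult monoid.l_one[OF assms(1)] monoid.r_one[OF assms(1)])

lemma monoid_algebra_mult_scale:
  fixes c :: complex
  shows "Poly_Mapping.map ((*) c) p \<otimes>\<^bsub>monoid_algebra M\<^esub> r = Poly_Mapping.map ((*) c) (p \<otimes>\<^bsub>monoid_algebra M\<^esub> r)"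
    "p \<otimes>\<^bsub>monoid_algebra M\<^esub> Poly_Mapping.map ((*) c) r = Poly_Mapping.map ((*) c) (p \<otimes>\<^bsub>monoid_algebra M\<^esub> r)"
proof -
  have "Poly_Mapping.map ((*) c) p \<otimes>\<^bsub>monoid_algebra M\<^esub> r = Poly_Mapping.map ((*) c) (p \<otimes>\<^bsub>monoid_algebra M\<^esub> r) \<and>
    p \<otimes>\<^bsub>monoid_algebra M\<^esub> Poly_Mapping.map ((*) c) r = Poly_Mapping.map ((*) c) (p \<otimes>\<^bsub>monoid_algebra M\<^esub> r)"
    using subset_UNIV[of "Poly_Mapping.keys p"]
  proof (induction rule: poly_mapping_single_induct)
    case (single x d)
    show ?case
      using subset_UNIV[of "Poly_Mapping.keys r"]
      by (induction rule: poly_mapping_single_induct)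
        (simp_all add: monoid_algebra_mult map_scale_zero map_scale_add map_scale_single mult.assoc mult.left_commute del: map_single)
  qed (simp_all add: monoid_algebra_mult map_scale_zero map_scale_add)
  then show "Poly_Mapping.map ((*) c) p \<otimes>\<^bsub>monoid_algebra M\<^esub> r = Poly_Mapping.map ((*) c) (p \<otimes>\<^bsub>monoid_algebra M\<^esub> r)"
    "p \<otimes>\<^bsub>monoid_algebra M\<^esub> Poly_Mapping.map ((*) c) r = Poly_Mapping.map ((*) c) (p \<otimes>\<^bsub>monoid_algebra M\<^esub> r)"
    by auto
qed

lemma complex_alg_monoid_algebra:
  assumes "Group.monoid M"
  shows "complex_alg (monoid_algebra M)"
proof (intro complex_alg.intro complex_alg_axioms.intro ringI)
  show "abelian_group (monoid_algebra M)"
  proof (rule abelian_groupI)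
    fix p r
    assume "p \<in> carrier (monoid_algebra M)" "r \<in> carrier (monoid_algebra M)"
    then show "p \<oplus>\<^bsub>monoid_algebra M\<^esub> r \<in> carrier (monoid_algebra M)"
      using keys_add by (force simp: monoid_algebra_simps)
  next
    fix p
    assume "p \<in> carrier (monoid_algebra M)"
    moreover have "Poly_Mapping.keys (- p) = Poly_Mapping.keys p"
      by (auto simp: in_keys_iff)
    ultimately show "\<exists>r\<in>carrier (monoid_algebra M). r \<oplus>\<^bsub>monoid_algebra M\<^esub> p = \<zero>\<^bsub>monoid_algebra M\<^esub>"
      by (intro bexI[of _ "- p"]) (auto simp: monoid_algebra_simps)
  qed (simp_all add: monoid_algebra_simps add_ac)
  show "Group.monoid (monoid_algebra M)"
    by (rule monoidI)
      (auto simp: monoid_algebra_simps monoid_algebra_mult_one assms monoid_algebra_assoc monoid.one_closed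
        dest: monoid_algebra_mult_closed[OF assms])
qed (auto dest: subsetD[OF keys_map_scale] simp: monoid_algebra_simps monoid_algebra_mult_scale monoid_algebra_mult
      map_scale_add map_scale_add_left map_scale_scale map_scale_one)

definition monoid_algebra_lift :: "(complex, 'b) module \<Rightarrow> ('a \<Rightarrow> 'b) \<Rightarrow> ('a \<Rightarrow>\<^sub>0 complex) \<Rightarrow> 'b" where
  "monoid_algebra_lift B h p = (\<Oplus>\<^bsub>B\<^esub>x\<in>Poly_Mapping.keys p. Poly_Mapping.lookup p x \<odot>\<^bsub>B\<^esub> h x)"

text \<open>Additivity follows by summing over the union of both supports. Multiplicativity then
  reduces, by induction on each argument, to basis elements, where it is the assumption on
  \<open>h\<close>.\<close>

lemma monoid_algebra_lift_hom:
  assumes "complex_alg B" and M: "Group.monoid M"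
    and h: "\<And>x. x \<in> carrier M \<Longrightarrow> h x \<in> carrier B"
    and h_one: "h \<one>\<^bsub>M\<^esub> = \<one>\<^bsub>B\<^esub>"
    and h_mult: "\<And>x y. x \<in> carrier M \<Longrightarrow> y \<in> carrier M \<Longrightarrow> h (x \<otimes>\<^bsub>M\<^esub> y) = h x \<otimes>\<^bsub>B\<^esub> h y"
  shows "monoid_algebra_lift B h \<in> algebra_hom (monoid_algebra M) B"
    and "x \<in> carrier M \<Longrightarrow> monoid_algebra_lift B h (Poly_Mapping.single x c) = c \<odot>\<^bsub>B\<^esub> h x"
proof -
  interpret B: complex_alg B by fact
  let ?L = "monoid_algebra_lift B h"
  have eq: "?L p = (\<Oplus>\<^bsub>B\<^esub>x\<in>S. Poly_Mapping.lookup p x \<odot>\<^bsub>B\<^esub> h x)"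
    if "finite S" "Poly_Mapping.keys p \<subseteq> S" "S \<subseteq> carrier M" for p S
    unfolding monoid_algebra_lift_def
    using that h by (intro B.add.finprod_mono_neutral_cong_left) (auto simp: in_keys_iff subset_eq)
  have closed: "?L p \<in> carrier B" if "Poly_Mapping.keys p \<subseteq> carrier M" for p
    unfolding monoid_algebra_lift_def using that h by (intro B.finsum_closed) auto
  have lift_single: "?L (Poly_Mapping.single x c) = c \<odot>\<^bsub>B\<^esub> h x" if "x \<in> carrier M" for x c
    using that h by (subst eq[of "{x}"]) (auto simp: B.finsum_insert)
  have lift_add: "?L (p + r) = ?L p \<oplus>\<^bsub>B\<^esub> ?L r"
    if "Poly_Mapping.keys p \<subseteq> carrier M" "Poly_Mapping.keys r \<subseteq> carrier M" for p r
  proof -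
    let ?S = "Poly_Mapping.keys p \<union> Poly_Mapping.keys r"
    have "?L (p + r) = (\<Oplus>\<^bsub>B\<^esub>x\<in>?S. Poly_Mapping.lookup (p + r) x \<odot>\<^bsub>B\<^esub> h x)"
      using that keys_add[of p r] by (intro eq) auto
    also have "\<dots> = (\<Oplus>\<^bsub>B\<^esub>x\<in>?S. Poly_Mapping.lookup p x \<odot>\<^bsub>B\<^esub> h x \<oplus>\<^bsub>B\<^esub> Poly_Mapping.lookup r x \<odot>\<^bsub>B\<^esub> h x)"
      using that h by (intro B.finsum_cong') (auto simp: lookup_add B.smult_l_distr subset_eq)
    also have "\<dots> = (\<Oplus>\<^bsub>B\<^esub>x\<in>?S. Poly_Mapping.lookup p x \<odot>\<^bsub>B\<^esub> h x) \<oplus>\<^bsub>B\<^esub>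
      (\<Oplus>\<^bsub>B\<^esub>x\<in>?S. Poly_Mapping.lookup r x \<odot>\<^bsub>B\<^esub> h x)"
      using that h by (intro B.finsum_addf) (auto simp: subset_eq)
    also have "\<dots> = ?L p \<oplus>\<^bsub>B\<^esub> ?L r"
      using that eq[of ?S p] eq[of ?S r] by simp
    finally show ?thesis .
  qed
  have carr: "Poly_Mapping.keys (Poly_Mapping.single x c) \<subseteq> carrier M" if "x \<in> carrier M" for x and c :: complex
    using that by simp
  have lift_zero: "?L 0 = \<zero>\<^bsub>B\<^esub>"
    by (simp add: monoid_algebra_lift_def)
  show "?L (Poly_Mapping.single x c) = c \<odot>\<^bsub>B\<^esub> h x" if "x \<in> carrier M"
    using that by (rule lift_single)
  show "?L \<in> algebra_hom (monoid_algebra M) B"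
  proof (rule algebra_homI)
    fix p r
    assume "p \<in> carrier (monoid_algebra M)" "r \<in> carrier (monoid_algebra M)"
    then have p: "Poly_Mapping.keys p \<subseteq> carrier M" and r: "Poly_Mapping.keys r \<subseteq> carrier M"
      by (simp_all add: monoid_algebra_simps)
    show "?L (p \<oplus>\<^bsub>monoid_algebra M\<^esub> r) = ?L p \<oplus>\<^bsub>B\<^esub> ?L r"
      using p r by (simp add: monoid_algebra_simps lift_add)
    show "?L (p \<otimes>\<^bsub>monoid_algebra M\<^esub> r) = ?L p \<otimes>\<^bsub>B\<^esub> ?L r"
      using p
    proof (induction rule: poly_mapping_single_induct)
      case (single x c)
      show ?case
        using r
      proof (induction rule: poly_mapping_single_induct)
        case (single y d)
        then show ?case
          using \<open>x \<in> carrier M\<close>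
          by (simp add: monoid_algebra_mult lift_single monoid.m_closed[OF M] h h_mult
              B.mult_smult_left B.mult_smult_right B.smult_smult mult.commute)
      next
        case (add p r)
        then show ?case
          using \<open>x \<in> carrier M\<close>
          by (simp add: monoid_algebra_mult lift_add closed carr B.r_distr monoid_algebra_mult_closed[OF M])
      qed (use \<open>x \<in> carrier M\<close> in \<open>simp add: monoid_algebra_mult lift_zero closed carr\<close>)
    next
      case (add p p')
      then show ?case
        by (simp add: monoid_algebra_mult lift_add r closed B.l_distr monoid_algebra_mult_closed[OF M])
    qed (simp add: monoid_algebra_mult lift_zero closed r)
  next
    fix c p
    assume "p \<in> carrier (monoid_algebra M)"
    then have "Poly_Mapping.keys p \<subseteq> carrier M"
      by (simp add: monoid_algebra_simps)
    then show "?L (c \<odot>\<^bsub>monoid_algebra M\<^esub> p) = c \<odot>\<^bsub>B\<^esub> ?L p"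
      unfolding monoid_algebra_simps
    proof (induction rule: poly_mapping_single_induct)
      case (add p r)
      then show ?case
        using keys_map_scale[of c p] keys_map_scale[of c r]
        by (simp add: map_scale_add lift_add closed B.smult_r_distr)
    next
      case (single x d)
      then show ?case
        by (simp add: map_scale_single lift_single h B.smult_smult del: map_single)
    next
      \<comment> \<open>That a scalar multiple of zero vanishes is derived by writing zero as
        \<open>0 \<odot> \<zero>\<close>.\<close>
      case zero
      then show ?case
        using B.smult_zero_left[of "\<zero>\<^bsub>B\<^esub>"] B.smult_smult[of "\<zero>\<^bsub>B\<^esub>" c 0]
        by (simp add: map_scale_zero lift_zero)
    qed
  qed (simp_all add: monoid_algebra_simps closed lift_single monoid.one_closed[OF M] h_one)
qed

section \<open>Quotients\<close>

locale alg_ideal = complex_alg A + ideal I A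
  for A :: "(complex, 'a) module" (structure) and I
begin

text \<open>Scaling by \<open>c\<close> is multiplication by \<open>c \<odot> \<one>\<close>, so a
  ring ideal of a unital algebra is a subspace and the ring quotient inherits scalars.\<close>

lemma smult_ideal_closed: "x \<in> I \<Longrightarrow> c \<odot> x \<in> I"
  using I_l_closed[of x "c \<odot> \<one>"] by (simp add: mult_smult_left a_Hcarr)

lemma quotient_algebra_carrier: "carrier (quotient_algebra A I) = (+>) I ` carrier A"
  by (auto simp: quotient_algebra_def FactRing_simps)

lemma quotient_algebra_zero: "\<zero>\<^bsub>quotient_algebra A I\<^esub> = I +> \<zero>"
  by (simp add: quotient_algebra_def FactRing_def a_subset)

lemma quotient_algebra_one: "\<one>\<^bsub>quotient_algebra A I\<^esub> = I +> \<one>"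
  by (simp add: quotient_algebra_def FactRing_def)

lemma quotient_algebra_mult:
  "x \<in> carrier A \<Longrightarrow> y \<in> carrier A \<Longrightarrow> (I +> x) \<otimes>\<^bsub>quotient_algebra A I\<^esub> (I +> y) = I +> (x \<otimes> y)"
  by (simp add: quotient_algebra_def FactRing_def rcoset_mult_add)

lemma quotient_algebra_add:
  "x \<in> carrier A \<Longrightarrow> y \<in> carrier A \<Longrightarrow> (I +> x) \<oplus>\<^bsub>quotient_algebra A I\<^esub> (I +> y) = I +> (x \<oplus> y)"
  by (simp add: quotient_algebra_def FactRing_def a_rcos_sum)

text \<open>The definition takes a union over all representatives of the coset. They differ by
  elements of \<open>I\<close>, which is stable under scaling, so all members of the union
  coincide.\<close>

lemma quotient_algebra_smult:
  assumes "x \<in> carrier A"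
  shows "c \<odot>\<^bsub>quotient_algebra A I\<^esub> (I +> x) = I +> (c \<odot> x)"
proof -
  have "I +> (c \<odot> y) = I +> (c \<odot> x)" if y: "y \<in> I +> x" for y
  proof -
    obtain i where i: "i \<in> I" "y = i \<oplus> x"
      using y by (auto simp: a_r_coset_def')
    then have "c \<odot> y \<in> I +> (c \<odot> x)"
      using assms smult_ideal_closed by (auto simp: a_r_coset_def' smult_r_distr a_Hcarr)
    then show ?thesis
      using assms a_repr_independence[OF _ _ a_subgroup] by (metis smult_closed)
  qed
  then have "(\<Union>y\<in>I +> x. I +> (c \<odot> y)) = I +> (c \<odot> x)"
    using a_rcos_self[OF assms] by blast
  then show ?thesis
    by (simp add: quotient_algebra_def)
qed

lemmas quotient_algebra_simps = quotient_algebra_carrier quotient_algebra_zero quotient_algebra_one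
  quotient_algebra_mult quotient_algebra_add quotient_algebra_smult

lemma complex_alg_quotient: "complex_alg (quotient_algebra A I)"
proof (intro complex_alg.intro complex_alg_axioms.intro ringI)
  show "abelian_group (quotient_algebra A I)"
  proof (rule abelian_groupI)
    fix C
    assume "C \<in> carrier (quotient_algebra A I)"
    then obtain x where "x \<in> carrier A" "C = I +> x"
      by (auto simp: quotient_algebra_simps)
    then show "\<exists>D\<in>carrier (quotient_algebra A I). D \<oplus>\<^bsub>quotient_algebra A I\<^esub> C = \<zero>\<^bsub>quotient_algebra A I\<^esub>"
      by (intro bexI[of _ "I +> (\<ominus> x)"]) (auto simp: quotient_algebra_simps l_neg)
  qed (auto simp: quotient_algebra_simps a_ac)
  show "Group.monoid (quotient_algebra A I)"
    by (rule monoidI) (auto simp: quotient_algebra_simps m_assoc)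
qed (auto simp: quotient_algebra_simps l_distr r_distr smult_r_distr smult_l_distr smult_smult
    mult_smult_left mult_smult_right)

lemma coset_hom: "(+>) I \<in> algebra_hom A (quotient_algebra A I)"
  by (rule algebra_homI) (simp_all add: quotient_algebra_simps)

lemma coset_of_ideal: "x \<in> I \<Longrightarrow> I +> x = \<zero>\<^bsub>quotient_algebra A I\<^esub>"
  by (simp add: quotient_algebra_def FactRing_def a_rcos_const)

text \<open>Vanishing on \<open>I\<close> makes \<open>h\<close> constant on each coset; its image
  there is a singleton, whose element is the value of \<phi>.\<close>

lemma quotient_algebra_lift:
  assumes "complex_alg B" and h: "h \<in> algebra_hom A B" and zero: "\<And>x. x \<in> I \<Longrightarrow> h x = \<zero>\<^bsub>B\<^esub>"
  obtains \<phi> where "\<phi> \<in> algebra_hom (quotient_algebra A I) B" "\<And>x. x \<in> carrier A \<Longrightarrow> \<phi> (I +> x) = h x"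
proof -
  interpret B: complex_alg B by fact
  have "h ` (I +> x) = {h x}" if "x \<in> carrier A" for x
  proof -
    have "h y = h x" if "y \<in> I +> x" for y
      using that \<open>x \<in> carrier A\<close> zero a_Hcarr
      by (auto simp: a_r_coset_def' algebra_homD[OF h])
    then show ?thesis
      using a_rcos_self[OF that] by blast
  qed
  then have eq: "the_elem (h ` (I +> x)) = h x" if "x \<in> carrier A" for x
    using that by simp
  show thesis
  proof (rule that)
    show "(\<lambda>C. the_elem (h ` C)) \<in> algebra_hom (quotient_algebra A I) B"
      by (rule algebra_homI) (auto simp: quotient_algebra_simps eq algebra_homD[OF h])
  qed (rule eq)
qed

end

text \<open>The kernel of \<open>h\<close> is an ideal containing \<open>S\<close>, hence it
  contains the ideal generated by \<open>S\<close>.\<close>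

lemma algebra_hom_vanishes_on_genideal:
  assumes "complex_alg A" "complex_alg B" and h: "h \<in> algebra_hom A B" and "S \<subseteq> carrier A"
    and "\<And>s. s \<in> S \<Longrightarrow> h s = \<zero>\<^bsub>B\<^esub>" and "x \<in> Idl\<^bsub>A\<^esub> S"
  shows "h x = \<zero>\<^bsub>B\<^esub>"
proof -
  interpret A: complex_alg A by fact
  interpret B: complex_alg B by fact
  have "h \<in> ring_hom A B"
    using h by (simp add: algebra_hom_def)
  then interpret h: ring_hom_ring A B h
    by (intro ring_hom_ringI2 A.ring_axioms B.ring_axioms)
  have "S \<subseteq> a_kernel A B h"
    using assms(4,5) unfolding a_kernel_def' by blast
  then have "Idl\<^bsub>A\<^esub> S \<subseteq> a_kernel A B h"
    by (rule A.genideal_minimal[OF h.kernel_is_ideal])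
  then show ?thesis
    using assms(6) unfolding a_kernel_def' by blast
qed


section \<open>Tensor products of algebras\<close>

locale alg_pair = A: complex_alg A + B: complex_alg B
  for A :: "(complex, 'a) module" and B :: "(complex, 'b) module"
begin

lemma monoid_DirProd: "Group.monoid (A \<times>\<times> B)"
  by (rule DirProd_monoid[OF A.monoid_axioms B.monoid_axioms])

sublocale MA: complex_alg "monoid_algebra (A \<times>\<times> B)"
  by (rule complex_alg_monoid_algebra) (rule monoid_DirProd)

lemma single_carrier:
  "a \<in> carrier A \<Longrightarrow> b \<in> carrier B \<Longrightarrow> Poly_Mapping.single (a, b) c \<in> carrier (monoid_algebra (A \<times>\<times> B))"
  by (simp add: monoid_algebra_simps)

text \<open>The relators use subtraction of finitely supported functions, not the ring operation, so
  closure is checked on supports.\<close>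

lemma minus_carrier:
  assumes "p \<in> carrier (monoid_algebra (A \<times>\<times> B))" "r \<in> carrier (monoid_algebra (A \<times>\<times> B))"
  shows "p - r \<in> carrier (monoid_algebra (A \<times>\<times> B))"
proof -
  have "Poly_Mapping.keys (p - r) \<subseteq> Poly_Mapping.keys p \<union> Poly_Mapping.keys r"
    by (auto simp: in_keys_iff lookup_minus)
  then show ?thesis
    using assms unfolding monoid_algebra_simps by blast
qed

lemma bilinear_relatorsI:
  "a \<in> carrier A \<Longrightarrow> a' \<in> carrier A \<Longrightarrow> b \<in> carrier B \<Longrightarrow> Poly_Mapping.single (a \<oplus>\<^bsub>A\<^esub> a', b) 1 -
    Poly_Mapping.single (a, b) 1 - Poly_Mapping.single (a', b) 1 \<in> bilinear_relators A B"
  "a \<in> carrier A \<Longrightarrow> b \<in> carrier B \<Longrightarrow> b' \<in> carrier B \<Longrightarrow> Poly_Mapping.single (a, b \<oplus>\<^bsub>B\<^esub> b') 1 -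
    Poly_Mapping.single (a, b) 1 - Poly_Mapping.single (a, b') 1 \<in> bilinear_relators A B"
  "a \<in> carrier A \<Longrightarrow> b \<in> carrier B \<Longrightarrow>
    Poly_Mapping.single (c \<odot>\<^bsub>A\<^esub> a, b) 1 - Poly_Mapping.single (a, b) c \<in> bilinear_relators A B"
  "a \<in> carrier A \<Longrightarrow> b \<in> carrier B \<Longrightarrow>
    Poly_Mapping.single (a, c \<odot>\<^bsub>B\<^esub> b) 1 - Poly_Mapping.single (a, b) c \<in> bilinear_relators A B"
  unfolding bilinear_relators_def
     apply (rule UnI1, rule UnI1, rule UnI1, blast)
    apply (rule UnI1, rule UnI1, rule UnI2, blast)
   apply (rule UnI1, rule UnI2, blast)
  apply (rule UnI2, blast)
  done

lemma bilinear_relators_carrier: "bilinear_relators A B \<subseteq> carrier (monoid_algebra (A \<times>\<times> B))"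
  unfolding bilinear_relators_def by (auto intro!: minus_carrier single_carrier)

sublocale BI: alg_ideal "monoid_algebra (A \<times>\<times> B)" "bilinear_ideal A B"
  unfolding bilinear_ideal_def
  by (intro alg_ideal.intro MA.genideal_ideal bilinear_relators_carrier MA.complex_alg_axioms)

sublocale AB: complex_alg "tensor_algebra A B"
  unfolding tensor_algebra_def by (rule BI.complex_alg_quotient)

lemma relator_coset:
  "u \<in> bilinear_relators A B \<Longrightarrow> bilinear_ideal A B +>\<^bsub>monoid_algebra (A \<times>\<times> B)\<^esub> u = \<zero>\<^bsub>tensor_algebra A B\<^esub>"
  unfolding tensor_algebra_def
  by (rule BI.coset_of_ideal) (use MA.genideal_self[OF bilinear_relators_carrier] in \<open>auto simp: bilinear_ideal_def\<close>)

text \<open>The quotient map is applied to \<open>p = (p - r) + r\<close>, where the first summand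
  goes to zero.\<close>

lemma coset_eqI:
  assumes "p - r \<in> bilinear_relators A B" "r \<in> carrier (monoid_algebra (A \<times>\<times> B))"
  shows "bilinear_ideal A B +>\<^bsub>monoid_algebra (A \<times>\<times> B)\<^esub> p = bilinear_ideal A B +>\<^bsub>monoid_algebra (A \<times>\<times> B)\<^esub> r"
proof -
  let ?\<pi> = "(+>\<^bsub>monoid_algebra (A \<times>\<times> B)\<^esub>) (bilinear_ideal A B)"
  have "p - r \<in> carrier (monoid_algebra (A \<times>\<times> B))"
    using assms bilinear_relators_carrier by auto
  then have "?\<pi> ((p - r) \<oplus>\<^bsub>monoid_algebra (A \<times>\<times> B)\<^esub> r) = ?\<pi> (p - r) \<oplus>\<^bsub>tensor_algebra A B\<^esub> ?\<pi> r"
    using assms by (simp add: algebra_homD[OF BI.coset_hom] tensor_algebra_def)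
  moreover have "?\<pi> r \<in> carrier (tensor_algebra A B)"
    using assms by (simp add: algebra_homD[OF BI.coset_hom] tensor_algebra_def)
  ultimately show ?thesis
    using relator_coset[OF assms(1)] by (simp add: monoid_algebra_simps)
qed

lemma pure_tensor_closed [simp]:
  "a \<in> carrier A \<Longrightarrow> b \<in> carrier B \<Longrightarrow> pure_tensor A B a b \<in> carrier (tensor_algebra A B)"
  unfolding pure_tensor_def tensor_algebra_def by (intro algebra_homD(1)[OF BI.coset_hom] single_carrier)

lemma pure_tensor_mult:
  assumes "a \<in> carrier A" "b \<in> carrier B" "a' \<in> carrier A" "b' \<in> carrier B"
  shows "pure_tensor A B a b \<otimes>\<^bsub>tensor_algebra A B\<^esub> pure_tensor A B a' b' =
    pure_tensor A B (a \<otimes>\<^bsub>A\<^esub> a') (b \<otimes>\<^bsub>B\<^esub> b')"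
  using algebra_homD(2)[OF BI.coset_hom, OF single_carrier[OF assms(1,2), of 1] single_carrier[OF assms(3,4), of 1]]
  unfolding pure_tensor_def tensor_algebra_def monoid_algebra_mult_single mult_DirProd mult_1_left by (rule sym)

lemma pure_tensor_add_left:
  assumes "a \<in> carrier A" "a' \<in> carrier A" "b \<in> carrier B"
  shows "pure_tensor A B (a \<oplus>\<^bsub>A\<^esub> a') b = pure_tensor A B a b \<oplus>\<^bsub>tensor_algebra A B\<^esub> pure_tensor A B a' b"
proof -
  have "pure_tensor A B (a \<oplus>\<^bsub>A\<^esub> a') b = bilinear_ideal A B +>\<^bsub>monoid_algebra (A \<times>\<times> B)\<^esub>
    (Poly_Mapping.single (a, b) 1 \<oplus>\<^bsub>monoid_algebra (A \<times>\<times> B)\<^esub> Poly_Mapping.single (a', b) 1)"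
    unfolding pure_tensor_def
  proof (rule coset_eqI)
    show "Poly_Mapping.single (a \<oplus>\<^bsub>A\<^esub> a', b) 1 - (Poly_Mapping.single (a, b) 1 \<oplus>\<^bsub>monoid_algebra (A \<times>\<times> B)\<^esub>
      Poly_Mapping.single (a', b) 1) \<in> bilinear_relators A B"
      unfolding monoid_algebra_simps diff_diff_eq[symmetric] using assms by (rule bilinear_relatorsI(1))
  qed (use assms in \<open>simp add: single_carrier\<close>)
  then show ?thesis
    using assms by (simp add: pure_tensor_def tensor_algebra_def algebra_homD[OF BI.coset_hom] single_carrier)
qed

lemma pure_tensor_add_right:
  assumes "a \<in> carrier A" "b \<in> carrier B" "b' \<in> carrier B"
  shows "pure_tensor A B a (b \<oplus>\<^bsub>B\<^esub> b') = pure_tensor A B a b \<oplus>\<^bsub>tensor_algebra A B\<^esub> pure_tensor A B a b'"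
proof -
  have "pure_tensor A B a (b \<oplus>\<^bsub>B\<^esub> b') = bilinear_ideal A B +>\<^bsub>monoid_algebra (A \<times>\<times> B)\<^esub>
    (Poly_Mapping.single (a, b) 1 \<oplus>\<^bsub>monoid_algebra (A \<times>\<times> B)\<^esub> Poly_Mapping.single (a, b') 1)"
    unfolding pure_tensor_def
  proof (rule coset_eqI)
    show "Poly_Mapping.single (a, b \<oplus>\<^bsub>B\<^esub> b') 1 - (Poly_Mapping.single (a, b) 1 \<oplus>\<^bsub>monoid_algebra (A \<times>\<times> B)\<^esub>
      Poly_Mapping.single (a, b') 1) \<in> bilinear_relators A B"
      unfolding monoid_algebra_simps diff_diff_eq[symmetric] using assms by (rule bilinear_relatorsI(2))
  qed (use assms in \<open>simp add: single_carrier\<close>)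
  then show ?thesis
    using assms by (simp add: pure_tensor_def tensor_algebra_def algebra_homD[OF BI.coset_hom] single_carrier)
qed

lemma pure_tensor_smult:
  assumes "a \<in> carrier A" "b \<in> carrier B"
  shows "pure_tensor A B (c \<odot>\<^bsub>A\<^esub> a) b = c \<odot>\<^bsub>tensor_algebra A B\<^esub> pure_tensor A B a b"
    and "pure_tensor A B a (c \<odot>\<^bsub>B\<^esub> b) = c \<odot>\<^bsub>tensor_algebra A B\<^esub> pure_tensor A B a b"
proof -
  \<comment> \<open>Relators carry \<open>c\<close> as a coefficient; written as a scalar multiple
    it passes through the quotient map.\<close>
  let ?c = "c \<odot>\<^bsub>monoid_algebra (A \<times>\<times> B)\<^esub> Poly_Mapping.single (a, b) 1"
  have "?c = Poly_Mapping.single (a, b) c"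
    by (simp add: monoid_algebra_simps)
  then have "Poly_Mapping.single (c \<odot>\<^bsub>A\<^esub> a, b) 1 - ?c \<in> bilinear_relators A B"
    "Poly_Mapping.single (a, c \<odot>\<^bsub>B\<^esub> b) 1 - ?c \<in> bilinear_relators A B"
    using bilinear_relatorsI(3,4)[OF assms] by simp_all
  then have "pure_tensor A B (c \<odot>\<^bsub>A\<^esub> a) b = bilinear_ideal A B +>\<^bsub>monoid_algebra (A \<times>\<times> B)\<^esub> ?c"
    "pure_tensor A B a (c \<odot>\<^bsub>B\<^esub> b) = bilinear_ideal A B +>\<^bsub>monoid_algebra (A \<times>\<times> B)\<^esub> ?c"
    unfolding pure_tensor_def using assms by (simp_all add: coset_eqI single_carrier)
  then show "pure_tensor A B (c \<odot>\<^bsub>A\<^esub> a) b = c \<odot>\<^bsub>tensor_algebra A B\<^esub> pure_tensor A B a b"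
    "pure_tensor A B a (c \<odot>\<^bsub>B\<^esub> b) = c \<odot>\<^bsub>tensor_algebra A B\<^esub> pure_tensor A B a b"
    using assms by (simp_all add: pure_tensor_def tensor_algebra_def algebra_homD[OF BI.coset_hom] single_carrier)
qed

lemma pure_tensor_lincomb_left:
  assumes "\<And>i. f i \<in> carrier A" "b \<in> carrier B"
  shows "pure_tensor A B (\<Oplus>\<^bsub>A\<^esub>i\<in>S. c i \<odot>\<^bsub>A\<^esub> f i) b =
    (\<Oplus>\<^bsub>tensor_algebra A B\<^esub>i\<in>S. c i \<odot>\<^bsub>tensor_algebra A B\<^esub> pure_tensor A B (f i) b)"
  using finsum_additive[where h = "\<lambda>a. pure_tensor A B a b" and f = "\<lambda>i. c i \<odot>\<^bsub>A\<^esub> f i"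
      and S = S and A = A and B = "tensor_algebra A B"] assms
  by (simp add: A.abelian_group_axioms AB.abelian_group_axioms pure_tensor_add_left pure_tensor_smult)

lemma pure_tensor_lincomb_right:
  assumes "\<And>i. f i \<in> carrier B" "a \<in> carrier A"
  shows "pure_tensor A B a (\<Oplus>\<^bsub>B\<^esub>i\<in>S. c i \<odot>\<^bsub>B\<^esub> f i) =
    (\<Oplus>\<^bsub>tensor_algebra A B\<^esub>i\<in>S. c i \<odot>\<^bsub>tensor_algebra A B\<^esub> pure_tensor A B a (f i))"
  using finsum_additive[where h = "\<lambda>b. pure_tensor A B a b" and f = "\<lambda>i. c i \<odot>\<^bsub>B\<^esub> f i"
      and S = S and A = B and B = "tensor_algebra A B"] assms
  by (simp add: B.abelian_group_axioms AB.abelian_group_axioms pure_tensor_add_right pure_tensor_smult)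

end

section \<open>The bialgebra of an R-matrix\<close>

context alg_pair
begin

text \<open>A matrix product in which entries are multiplied by the tensor product; taken of
  \<open>T\<close> with itself it is the matrix of coproducts of the generators.\<close>

definition tensor_matrix_mult :: "('m::finite \<Rightarrow> 'm \<Rightarrow> 'a) \<Rightarrow> ('m \<Rightarrow> 'm \<Rightarrow> 'b)
    \<Rightarrow> 'm \<Rightarrow> 'm \<Rightarrow> ('a \<times> 'b \<Rightarrow>\<^sub>0 complex) set" where
  "tensor_matrix_mult W W' p q = (\<Oplus>\<^bsub>tensor_algebra A B\<^esub>r\<in>UNIV. pure_tensor A B (W p r) (W' r q))"

context
  fixes W :: "'m::finite \<Rightarrow> 'm \<Rightarrow> 'a" and W' :: "'m \<Rightarrow> 'm \<Rightarrow> 'b"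
  assumes W [simp]: "\<And>p q. W p q \<in> carrier A" and W' [simp]: "\<And>p q. W' p q \<in> carrier B"
begin

lemma tensor_matrix_mult_closed [simp]: "tensor_matrix_mult W W' p q \<in> carrier (tensor_algebra A B)"
  by (simp add: tensor_matrix_mult_def)

lemma tensor_matrix_mult_lincomb_left:
  "(\<Oplus>\<^bsub>tensor_algebra A B\<^esub>r\<in>UNIV. c r \<odot>\<^bsub>tensor_algebra A B\<^esub> tensor_matrix_mult W W' r q) =
    (\<Oplus>\<^bsub>tensor_algebra A B\<^esub>s\<in>UNIV. pure_tensor A B (\<Oplus>\<^bsub>A\<^esub>r\<in>UNIV. c r \<odot>\<^bsub>A\<^esub> W r s) (W' s q))"
  unfolding tensor_matrix_mult_def
  by (simp add: AB.smult_finsum pure_tensor_lincomb_left) (rule AB.finsum_swap, simp)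

lemma tensor_matrix_mult_lincomb_right:
  "(\<Oplus>\<^bsub>tensor_algebra A B\<^esub>r\<in>UNIV. c r \<odot>\<^bsub>tensor_algebra A B\<^esub> tensor_matrix_mult W W' p r) =
    (\<Oplus>\<^bsub>tensor_algebra A B\<^esub>s\<in>UNIV. pure_tensor A B (W p s) (\<Oplus>\<^bsub>B\<^esub>r\<in>UNIV. c r \<odot>\<^bsub>B\<^esub> W' s r))"
  unfolding tensor_matrix_mult_def
  by (simp add: AB.smult_finsum pure_tensor_lincomb_right) (rule AB.finsum_swap, simp)

text \<open>The matrix \<open>M\<close> travels through the product: it crosses \<open>W\<close> in
  the first slot, is moved to the second slot by bilinearity and crosses \<open>W'\<close> there.
  This is why the coproduct respects the defining relations.\<close>

lemma intertwines_tensor_matrix_mult: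
  assumes "A.intertwines M W" "B.intertwines M W'"
  shows "AB.intertwines M (tensor_matrix_mult W W')"
  unfolding AB.intertwines_def
proof (intro allI)
  fix p q
  have "(\<Oplus>\<^bsub>tensor_algebra A B\<^esub>r\<in>UNIV. M $ p $ r \<odot>\<^bsub>tensor_algebra A B\<^esub> tensor_matrix_mult W W' r q) =
    (\<Oplus>\<^bsub>tensor_algebra A B\<^esub>s\<in>UNIV. \<Oplus>\<^bsub>tensor_algebra A B\<^esub>r\<in>UNIV.
      M $ r $ s \<odot>\<^bsub>tensor_algebra A B\<^esub> pure_tensor A B (W p r) (W' s q))"
    using assms(1) by (simp add: tensor_matrix_mult_lincomb_left A.intertwines_def pure_tensor_lincomb_left)
  also have "\<dots> = (\<Oplus>\<^bsub>tensor_algebra A B\<^esub>r\<in>UNIV. \<Oplus>\<^bsub>tensor_algebra A B\<^esub>s\<in>UNIV.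
      M $ r $ s \<odot>\<^bsub>tensor_algebra A B\<^esub> pure_tensor A B (W p r) (W' s q))"
    by (rule AB.finsum_swap) simp
  also have "\<dots> = (\<Oplus>\<^bsub>tensor_algebra A B\<^esub>r\<in>UNIV. pure_tensor A B (W p r) (\<Oplus>\<^bsub>B\<^esub>s\<in>UNIV. M $ r $ s \<odot>\<^bsub>B\<^esub> W' s q))"
    by (simp add: pure_tensor_lincomb_right)
  also have "\<dots> = (\<Oplus>\<^bsub>tensor_algebra A B\<^esub>r\<in>UNIV. M $ r $ q \<odot>\<^bsub>tensor_algebra A B\<^esub> tensor_matrix_mult W W' p r)"
    using assms(2) by (simp add: tensor_matrix_mult_lincomb_right B.intertwines_def)
  finally show "(\<Oplus>\<^bsub>tensor_algebra A B\<^esub>r\<in>UNIV. M $ p $ r \<odot>\<^bsub>tensor_algebra A B\<^esub> tensor_matrix_mult W W' r q) = \<dots>" .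
qed

end

end

text \<open>The matrix \<open>T\<^sub>1 T\<^sub>2\<close>, indexed by pairs.\<close>

definition double_matrix :: "(complex, 'a) module \<Rightarrow> ('n \<Rightarrow> 'n \<Rightarrow> 'a) \<Rightarrow> 'n \<times> 'n \<Rightarrow> 'n \<times> 'n \<Rightarrow> 'a" where
  "double_matrix A T p q = T (fst p) (fst q) \<otimes>\<^bsub>A\<^esub> T (snd p) (snd q)"

lemma (in complex_alg) double_matrix_closed [simp]:
  "(\<And>i j. T i j \<in> carrier A) \<Longrightarrow> double_matrix A T p q \<in> carrier A"
  by (simp add: double_matrix_def)

text \<open>Elements of different tensor slots commute, so doubling a matrix and forming tensor
  matrix products can be interchanged. This carries the coproduct from \<open>T\<close> over to
  \<open>T\<^sub>1 T\<^sub>2\<close>.\<close>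

lemma (in alg_pair) double_matrix_tensor_matrix_mult:
  assumes W [simp]: "\<And>i j. W i j \<in> carrier A" and W' [simp]: "\<And>i j. W' i j \<in> carrier B"
  shows "double_matrix (tensor_algebra A B) (tensor_matrix_mult W W') =
    tensor_matrix_mult (double_matrix A W) (double_matrix B W')"
proof (intro ext)
  fix p q
  have "double_matrix (tensor_algebra A B) (tensor_matrix_mult W W') p q =
    (\<Oplus>\<^bsub>tensor_algebra A B\<^esub>a\<in>UNIV. \<Oplus>\<^bsub>tensor_algebra A B\<^esub>b\<in>UNIV.
      pure_tensor A B (W (fst p) a) (W' a (fst q)) \<otimes>\<^bsub>tensor_algebra A B\<^esub> pure_tensor A B (W (snd p) b) (W' b (snd q)))"
    by (simp add: double_matrix_def tensor_matrix_mult_def AB.mult_finsum_left AB.mult_finsum_right)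
      (rule AB.finsum_swap, simp)
  also have "\<dots> = tensor_matrix_mult (double_matrix A W) (double_matrix B W') p q"
    by (subst AB.finsum_pairs) (simp_all add: pure_tensor_mult tensor_matrix_mult_def double_matrix_def)
  finally show "double_matrix (tensor_algebra A B) (tensor_matrix_mult W W') p q = \<dots>" .
qed

section \<open>Homomorphisms out of the free algebra\<close>

lemma monoid_words: "Group.monoid \<lparr>carrier = UNIV, mult = (@), one = []\<rparr>"
  by (rule monoidI) auto

interpretation free: complex_alg free_algebra
  unfolding free_algebra_def by (rule complex_alg_monoid_algebra) (rule monoid_words)

lemma free_algebra_simps:
  "carrier free_algebra = UNIV"
  "\<one>\<^bsub>free_algebra\<^esub> = Poly_Mapping.single [] 1"
  "\<zero>\<^bsub>free_algebra\<^esub> = 0"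
  "p \<oplus>\<^bsub>free_algebra\<^esub> r = p + r"
  "c \<odot>\<^bsub>free_algebra\<^esub> Poly_Mapping.single w d = Poly_Mapping.single w (c * d)"
  "Poly_Mapping.single v c \<otimes>\<^bsub>free_algebra\<^esub> Poly_Mapping.single w d = Poly_Mapping.single (v @ w) (c * d)"
  by (simp_all add: free_algebra_def monoid_algebra_simps monoid_algebra_mult)

lemma finsum_free_algebra: "finite S \<Longrightarrow> (\<Oplus>\<^bsub>free_algebra\<^esub>i\<in>S. f i) = (\<Sum>i\<in>S. f i)"
  by (induction rule: finite_induct) (simp_all add: free.finsum_insert free_algebra_simps)

context
  fixes B :: "(complex, 'b) module" and h
  assumes B: "complex_alg B" and h: "h \<in> algebra_hom free_algebra B"
begin

interpretation B: complex_alg B by (rule B)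

lemma free_algebra_hom_sum:
  assumes "finite S"
  shows "h (\<Sum>i\<in>S. f i) = (\<Oplus>\<^bsub>B\<^esub>i\<in>S. h (f i))"
  using algebra_hom_finsum[OF free.complex_alg_axioms B h, of f S] assms
  by (simp add: finsum_free_algebra free_algebra_simps)

lemma free_algebra_hom_diff_eq_zero: "h (p - r) = \<zero>\<^bsub>B\<^esub> \<longleftrightarrow> h p = h r"
proof -
  have eq: "h p = h (p - r) \<oplus>\<^bsub>B\<^esub> h r"
    using algebra_homD(3)[OF h, of "p - r" r] by (simp add: free_algebra_simps)
  have "h x \<in> carrier B" for x
    using algebra_homD(1)[OF h] by (simp add: free_algebra_simps)
  then show ?thesis
    unfolding eq by (simp only: B.add.r_cancel_one)
qed

lemma free_algebra_hom_word2:
  "h (Poly_Mapping.single [x, y] c) = c \<odot>\<^bsub>B\<^esub> (h (Poly_Mapping.single [x] 1) \<otimes>\<^bsub>B\<^esub> h (Poly_Mapping.single [y] 1))"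
proof -
  have "Poly_Mapping.single [x, y] c =
    c \<odot>\<^bsub>free_algebra\<^esub> (Poly_Mapping.single [x] 1 \<otimes>\<^bsub>free_algebra\<^esub> Poly_Mapping.single [y] 1)"
    by (simp add: free_algebra_simps)
  then show ?thesis
    by (simp only: algebra_homD(2,5)[OF h] free_algebra_simps(1) UNIV_I)
qed

end

text \<open>Each relator is one entry of
  \<open>R T\<^sub>1 T\<^sub>2 - T\<^sub>1 T\<^sub>2 R\<close>. The forward direction, for the
  quotient map, gives the relations among the generators; the backward one lets homomorphisms
  descend to the quotient.\<close>

lemma FRT_relators_vanish_iff:
  fixes R :: "complex^('n::finite \<times> 'n)^('n \<times> 'n)"
  assumes "complex_alg B" and h: "h \<in> algebra_hom free_algebra B"
  shows "(\<forall>u\<in>FRT_relators R. h u = \<zero>\<^bsub>B\<^esub>) \<longleftrightarrow>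
    complex_alg.intertwines B R (double_matrix B (\<lambda>i j. h (Poly_Mapping.single [(i, j)] 1)))"
proof -
  interpret B: complex_alg B by fact
  show ?thesis
    unfolding FRT_relators_def B.intertwines_def split_paired_All sum_pairs double_matrix_def fst_conv snd_conv
    by (fastforce simp: free_algebra_hom_diff_eq_zero[OF assms] free_algebra_hom_sum[OF assms]
        free_algebra_hom_word2[OF assms])
qed

section \<open>Universal property of the algebra given by the generators and relations\<close>

context
  fixes R :: "complex^('n::finite \<times> 'n)^('n \<times> 'n)"
begin

interpretation I: alg_ideal free_algebra "FRT_ideal R"
  unfolding FRT_ideal_def
  by (intro alg_ideal.intro free.genideal_ideal free.complex_alg_axioms) (simp add: free_algebra_simps)

lemma complex_alg_FRT: "complex_alg (FRT R)"
  unfolding FRT_def by (rule I.complex_alg_quotient)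

interpretation F: complex_alg "FRT R" by (rule complex_alg_FRT)

lemma FRT_coset_hom: "(+>\<^bsub>free_algebra\<^esub>) (FRT_ideal R) \<in> algebra_hom free_algebra (FRT R)"
  unfolding FRT_def by (rule I.coset_hom)

lemma FRT_gen_closed [simp]: "FRT_gen R i j \<in> carrier (FRT R)"
  using algebra_homD(1)[OF FRT_coset_hom] by (simp add: FRT_gen_def free_algebra_simps)

lemma FRT_gen_intertwines: "F.intertwines R (double_matrix (FRT R) (FRT_gen R))"
proof -
  have "FRT_ideal R +>\<^bsub>free_algebra\<^esub> u = \<zero>\<^bsub>FRT R\<^esub>" if "u \<in> FRT_relators R" for u
    using I.coset_of_ideal[of u] free.genideal_self[of "FRT_relators R"] that
    by (auto simp: FRT_def FRT_ideal_def free_algebra_simps)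
  then show ?thesis
    using FRT_relators_vanish_iff[OF complex_alg_FRT FRT_coset_hom, of R]
    by (simp flip: FRT_gen_def)
qed

text \<open>Every element is the class of a linear combination of words, and a word is a product of
  generators.\<close>

lemma FRT_hom_unique:
  assumes "complex_alg B" "\<phi> \<in> algebra_hom (FRT R) B" "\<psi> \<in> algebra_hom (FRT R) B"
    and gen: "\<And>i j. \<phi> (FRT_gen R i j) = \<psi> (FRT_gen R i j)"
    and "x \<in> carrier (FRT R)"
  shows "\<phi> x = \<psi> x"
proof -
  interpret B: complex_alg B by fact
  let ?\<pi> = "(+>\<^bsub>free_algebra\<^esub>) (FRT_ideal R)"
  note hom = algebra_homD[OF algebra_hom_comp[OF FRT_coset_hom assms(2)], unfolded free_algebra_simps(1)]
    algebra_homD[OF algebra_hom_comp[OF FRT_coset_hom assms(3)], unfolded free_algebra_simps(1)]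
  have word: "\<phi> (?\<pi> (Poly_Mapping.single w 1)) = \<psi> (?\<pi> (Poly_Mapping.single w 1))" for w
  proof (induction w)
    case Nil
    show ?case
      using algebra_homD(4)[OF algebra_hom_comp[OF FRT_coset_hom assms(2)]]
        algebra_homD(4)[OF algebra_hom_comp[OF FRT_coset_hom assms(3)]]
      by (simp add: free_algebra_simps)
  next
    case (Cons z w)
    have "Poly_Mapping.single (z # w) 1 = Poly_Mapping.single [z] 1 \<otimes>\<^bsub>free_algebra\<^esub> Poly_Mapping.single w (1::complex)"
      by (simp add: free_algebra_simps)
    then show ?case
      using Cons gen[of "fst z" "snd z"] by (simp add: hom FRT_gen_def)
  qed
  have "\<phi> (?\<pi> p) = \<psi> (?\<pi> p)" for p
    using subset_UNIV[of "Poly_Mapping.keys p"]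
  proof (induction rule: poly_mapping_single_induct)
    case zero
    show ?case
      using hom(5)[of 0 0] hom(10)[of 0 0] hom(1)[of 0] hom(6)[of 0]
      by (simp add: free_algebra_def monoid_algebra_simps map_scale_zero)
  next
    case (single w c)
    have "Poly_Mapping.single w c = c \<odot>\<^bsub>free_algebra\<^esub> Poly_Mapping.single w 1"
      by (simp add: free_algebra_simps)
    then show ?case
      using word[of w] by (simp add: hom)
  next
    case (add p r)
    then show ?case
      using hom(3)[of p r] hom(8)[of p r] by (simp add: free_algebra_simps)
  qed
  moreover obtain p where "x = ?\<pi> p"
    using assms(5) by (auto simp: FRT_def I.quotient_algebra_simps)
  ultimately show ?thesis
    by simp
qed

text \<open>Words are sent to products of the \<open>f i j\<close>, this is extended linearly to the
  free algebra, and the relations for \<open>f\<close> make the extension vanish on the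
  ideal.\<close>

lemma FRT_hom_exists:
  assumes "complex_alg B" and f: "\<And>i j. f i j \<in> carrier B"
    and f_int: "complex_alg.intertwines B R (double_matrix B f)"
  obtains \<phi> where "\<phi> \<in> algebra_hom (FRT R) B" "\<And>i j. \<phi> (FRT_gen R i j) = f i j"
proof -
  interpret B: complex_alg B by fact
  define h where "h w = foldr (\<lambda>z y. f (fst z) (snd z) \<otimes>\<^bsub>B\<^esub> y) w \<one>\<^bsub>B\<^esub>" for w
  have h: "h w \<in> carrier B" for w
    by (induction w) (simp_all add: h_def f)
  have h_app: "h (v @ w) = h v \<otimes>\<^bsub>B\<^esub> h w" for v w
    using h by (induction v) (simp_all add: h_def f B.m_assoc)
  let ?L = "monoid_algebra_lift B h"
  have L: "?L \<in> algebra_hom free_algebra B"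
    unfolding free_algebra_def
    by (rule monoid_algebra_lift_hom) (simp_all add: assms(1) monoid_words h h_app, simp add: h_def)
  have L_single: "?L (Poly_Mapping.single w c) = c \<odot>\<^bsub>B\<^esub> h w" for w c
    by (rule monoid_algebra_lift_hom(2)[OF assms(1) monoid_words])
      (simp_all add: h h_app, simp add: h_def)
  have L_gen: "?L (Poly_Mapping.single [(i, j)] 1) = f i j" for i j
    using f by (simp add: L_single h) (simp add: h_def)
  have "?L u = \<zero>\<^bsub>B\<^esub>" if "u \<in> FRT_relators R" for u
    using FRT_relators_vanish_iff[OF assms(1) L, of R] f_int that by (simp add: L_gen)
  then have "?L x = \<zero>\<^bsub>B\<^esub>" if "x \<in> FRT_ideal R" for x
    using algebra_hom_vanishes_on_genideal[OF free.complex_alg_axioms assms(1) L, of "FRT_relators R" x] that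
    by (simp add: FRT_ideal_def free_algebra_simps)
  then obtain \<phi> where "\<phi> \<in> algebra_hom (FRT R) B"
    "\<And>x. x \<in> carrier free_algebra \<Longrightarrow> \<phi> (FRT_ideal R +>\<^bsub>free_algebra\<^esub> x) = ?L x"
    using I.quotient_algebra_lift[OF assms(1) L] unfolding FRT_def by blast
  then show thesis
    using that L_gen by (simp add: FRT_gen_def free_algebra_simps)
qed

text \<open>Restriction to the carrier turns uniqueness on the carrier into equality of functions,
  which is what the definite descriptions of \<open>coproduct\<close> and \<open>counit\<close>
  require.\<close>

lemma FRT_hom_ex1:
  assumes "complex_alg B" "\<And>i j. f i j \<in> carrier B" "complex_alg.intertwines B R (double_matrix B f)"
  shows "\<exists>!\<phi>. \<phi> \<in> algebra_hom (FRT R) B \<and> \<phi> \<in> extensional (carrier (FRT R)) \<and>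
    (\<forall>i j. \<phi> (FRT_gen R i j) = f i j)"
proof -
  obtain \<phi> where \<phi>: "\<phi> \<in> algebra_hom (FRT R) B" "\<And>i j. \<phi> (FRT_gen R i j) = f i j"
    using FRT_hom_exists[OF assms] by blast
  show ?thesis
  proof (rule ex1I)
    show "restrict \<phi> (carrier (FRT R)) \<in> algebra_hom (FRT R) B \<and>
      restrict \<phi> (carrier (FRT R)) \<in> extensional (carrier (FRT R)) \<and>
      (\<forall>i j. restrict \<phi> (carrier (FRT R)) (FRT_gen R i j) = f i j)"
      using \<phi>(2) by (auto intro!: algebra_homI simp: algebra_homD[OF \<phi>(1)])
  next
    fix \<psi>
    assume \<psi>: "\<psi> \<in> algebra_hom (FRT R) B \<and> \<psi> \<in> extensional (carrier (FRT R)) \<and>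
      (\<forall>i j. \<psi> (FRT_gen R i j) = f i j)"
    then show "\<psi> = restrict \<phi> (carrier (FRT R))"
      using FRT_hom_unique[OF assms(1), of \<psi> \<phi>] \<phi> by (intro extensionalityI[of _ "carrier (FRT R)"]) auto
  qed
qed

section \<open>Existence of the coproduct and the counit\<close>

interpretation FF: alg_pair "FRT R" "FRT R" ..

text \<open>The tensor product of the generator matrix with itself satisfies the defining relations
  again, so the universal property supplies the unique map that \<open>THE\<close>
  describes.\<close>

lemma coproduct_hom: "coproduct R \<in> algebra_hom (FRT R) (tensor_algebra (FRT R) (FRT R))"
  and coproduct_gen: "coproduct R (FRT_gen R i j) = FF.tensor_matrix_mult (FRT_gen R) (FRT_gen R) i j"
proof -
  have "\<exists>!\<phi>. \<phi> \<in> algebra_hom (FRT R) (tensor_algebra (FRT R) (FRT R)) \<and> \<phi> \<in> extensional (carrier (FRT R)) \<and>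
    (\<forall>i j. \<phi> (FRT_gen R i j) = FF.tensor_matrix_mult (FRT_gen R) (FRT_gen R) i j)"
    by (rule FRT_hom_ex1)
      (simp_all add: FF.AB.complex_alg_axioms FF.double_matrix_tensor_matrix_mult
        FF.intertwines_tensor_matrix_mult FRT_gen_intertwines)
  from theI'[OF this] show "coproduct R \<in> algebra_hom (FRT R) (tensor_algebra (FRT R) (FRT R))"
    "coproduct R (FRT_gen R i j) = FF.tensor_matrix_mult (FRT_gen R) (FRT_gen R) i j"
    unfolding coproduct_def FF.tensor_matrix_mult_def by auto
qed

lemma complex_alg_complex: "complex_alg complex_algebra"
proof (intro complex_alg.intro complex_alg_axioms.intro ringI)
  show "abelian_group complex_algebra"
    by (rule abelian_groupI) (auto simp: complex_algebra_def intro: exI[of _ "- _"])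
  show "Group.monoid complex_algebra"
    by (rule monoidI) (auto simp: complex_algebra_def)
qed (auto simp: complex_algebra_def algebra_simps)

interpretation C: complex_alg complex_algebra by (rule complex_alg_complex)

lemma counit_hom: "counit R \<in> algebra_hom (FRT R) complex_algebra"
  and counit_gen: "counit R (FRT_gen R i j) = (if i = j then 1 else 0)"
proof -
  let ?\<delta> = "\<lambda>i j. if i = j then 1 else 0 :: complex"
  \<comment> \<open>\<open>T\<^sub>1 T\<^sub>2\<close> becomes the identity matrix on pairs, which
    commutes with \<open>R\<close>; \<open>?\<delta>\<close> stands for the identity over both index
    types.\<close>
  have \<delta>: "double_matrix complex_algebra ?\<delta> = ?\<delta>"
    by (intro ext) (auto simp: double_matrix_def complex_algebra_def prod_eq_iff)
  have "C.intertwines R ?\<delta>"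
  proof -
    have "(\<Oplus>\<^bsub>complex_algebra\<^esub>r\<in>UNIV. R $ p $ r \<odot>\<^bsub>complex_algebra\<^esub> ?\<delta> r q) = R $ p $ q" for p q
      using C.finsum_delta(2)[of "\<lambda>r. R $ p $ r" q 1] by (simp add: complex_algebra_def mult.commute)
    moreover have "(\<Oplus>\<^bsub>complex_algebra\<^esub>r\<in>UNIV. R $ r $ q \<odot>\<^bsub>complex_algebra\<^esub> ?\<delta> p r) = R $ p $ q" for p q
      using C.finsum_delta(1)[of "\<lambda>r. R $ r $ q" p 1] by (simp add: complex_algebra_def mult.commute)
    ultimately show ?thesis
      by (simp add: C.intertwines_def)
  qed
  then have "\<exists>!\<phi>. \<phi> \<in> algebra_hom (FRT R) complex_algebra \<and> \<phi> \<in> extensional (carrier (FRT R)) \<and>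
    (\<forall>i j. \<phi> (FRT_gen R i j) = ?\<delta> i j)"
    by (intro FRT_hom_ex1 complex_alg_complex) (simp_all only: \<delta>, simp add: complex_algebra_def)
  from theI'[OF this] show "counit R \<in> algebra_hom (FRT R) complex_algebra"
    "counit R (FRT_gen R i j) = ?\<delta> i j"
    unfolding counit_def by auto
qed

end

section \<open>Commutation of \<open>K\<close> with \<open>T\<^sub>1 T\<^sub>2\<close>, and
  contractions with \<open>g\<close> and \<open>gbar\<close>\<close>

lemma (in complex_alg) intertwines_K_hat:
  assumes W: "\<And>p q. W p q \<in> carrier A" and R: "intertwines R W"
  shows "intertwines (K_hat q \<nu> R) W"
proof -
  \<comment> \<open>The difference becomes a sum with a multiple by -1, so that closure of the
    commutant under constants, sums and products applies.\<close>
  have eq: "mat q - R = mat q + mat (- 1) ** R"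
    by (simp add: vec_eq_iff mat_mult_nth del: split_paired_All)
  show ?thesis
    unfolding K_hat_def eq by (intro intertwines_mult intertwines_add intertwines_mat W R)
qed

context complex_alg
begin

context
  fixes T :: "'n::finite \<Rightarrow> 'n \<Rightarrow> 'a" and g gbar :: "complex^'n^'n" and \<tau> :: 'a
  assumes T [simp]: "\<And>i j. T i j \<in> carrier A" and \<tau> [simp]: "\<tau> \<in> carrier A"
    and g: "\<And>s. (\<Oplus>r\<in>UNIV. g $ fst r $ snd r \<odot> double_matrix A T r s) = g $ fst s $ snd s \<odot> \<tau>"
    and gbar: "\<And>p. (\<Oplus>r\<in>UNIV. gbar $ fst r $ snd r \<odot> double_matrix A T p r) = gbar $ fst p $ snd p \<odot> \<tau>"
begin

text \<open>
  Both sides equal the sum over \<open>a, b, j, k\<close> of \<open>g\<^sup>j\<^sup>k gbar\<^sub>a\<^sub>b T\<^sub>i\<^sup>a T\<^sub>j\<^sup>b T\<^sub>k\<^sup>l\<close>, contracted in its first two, respectively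
  last two, generators.
\<close>

lemma contraction_exchange:
  "(\<Oplus>k\<in>UNIV. (gbar ** g) $ i $ k \<odot> (\<tau> \<otimes> T k l)) = (\<Oplus>a\<in>UNIV. (gbar ** g) $ a $ l \<odot> (T i a \<otimes> \<tau>))"
proof -
  have "(\<Oplus>k\<in>UNIV. (gbar ** g) $ i $ k \<odot> (\<tau> \<otimes> T k l)) =
    (\<Oplus>k\<in>UNIV. \<Oplus>j\<in>UNIV. g $ j $ k \<odot> ((gbar $ i $ j \<odot> \<tau>) \<otimes> T k l))"
    by (rule finsum_eqI) (simp_all add: matrix_matrix_mult_def sum_smult mult_smult_left smult_smult mult.commute)
  also have "\<dots> = (\<Oplus>p\<in>UNIV. g $ fst p $ snd p \<odot> ((gbar $ i $ fst p \<odot> \<tau>) \<otimes> T (snd p) l))"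
    by (subst finsum_swap, simp, subst finsum_pairs, simp_all)
  also have "\<dots> = (\<Oplus>p\<in>UNIV. \<Oplus>r\<in>UNIV. (g $ fst p $ snd p * gbar $ fst r $ snd r) \<odot>
      (T i (fst r) \<otimes> T (fst p) (snd r) \<otimes> T (snd p) l))"
  proof (rule finsum_eqI)
    fix p :: "'n \<times> 'n"
    have "gbar $ i $ fst p \<odot> \<tau> = (\<Oplus>r\<in>UNIV. gbar $ fst r $ snd r \<odot> (T i (fst r) \<otimes> T (fst p) (snd r)))"
      using gbar[of "(i, fst p)"] by (simp add: double_matrix_def)
    then show "g $ fst p $ snd p \<odot> ((gbar $ i $ fst p \<odot> \<tau>) \<otimes> T (snd p) l) =
      (\<Oplus>r\<in>UNIV. (g $ fst p $ snd p * gbar $ fst r $ snd r) \<odot> (T i (fst r) \<otimes> T (fst p) (snd r) \<otimes> T (snd p) l))"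
      by (simp add: mult_finsum_left smult_finsum mult_smult_left smult_smult)
  qed simp
  also have "\<dots> = (\<Oplus>r\<in>UNIV. \<Oplus>p\<in>UNIV. (g $ fst p $ snd p * gbar $ fst r $ snd r) \<odot>
      (T i (fst r) \<otimes> T (fst p) (snd r) \<otimes> T (snd p) l))"
    by (rule finsum_swap) simp
  also have "\<dots> = (\<Oplus>r\<in>UNIV. gbar $ fst r $ snd r \<odot> (T i (fst r) \<otimes> (g $ snd r $ l \<odot> \<tau>)))"
  proof (rule finsum_eqI)
    fix r :: "'n \<times> 'n"
    have "g $ snd r $ l \<odot> \<tau> = (\<Oplus>p\<in>UNIV. g $ fst p $ snd p \<odot> (T (fst p) (snd r) \<otimes> T (snd p) l))"
      using g[of "(snd r, l)"] by (simp add: double_matrix_def)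
    then show "(\<Oplus>p\<in>UNIV. (g $ fst p $ snd p * gbar $ fst r $ snd r) \<odot>
        (T i (fst r) \<otimes> T (fst p) (snd r) \<otimes> T (snd p) l)) =
      gbar $ fst r $ snd r \<odot> (T i (fst r) \<otimes> (g $ snd r $ l \<odot> \<tau>))"
      by (simp add: mult_finsum_right smult_finsum mult_smult_right smult_smult m_assoc mult.commute)
  qed simp
  also have "\<dots> = (\<Oplus>a\<in>UNIV. \<Oplus>b\<in>UNIV. gbar $ a $ b \<odot> (T i a \<otimes> (g $ b $ l \<odot> \<tau>)))"
    by (rule finsum_pairs[symmetric]) simp
  also have "\<dots> = (\<Oplus>a\<in>UNIV. (gbar ** g) $ a $ l \<odot> (T i a \<otimes> \<tau>))"
    by (rule finsum_eqI) (simp_all add: matrix_matrix_mult_def sum_smult mult_smult_right smult_smult)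
  finally show ?thesis .
qed

text \<open>The identity \<open>X ** (gbar ** g)\<close> is inserted in front of
  \<open>\<tau> T\<close>; the exchange of contractions moves \<tau> to the right end and leaves
  \<open>X\<close> and \<open>gbar ** g\<close> on the two sides of \<open>T\<close>.\<close>

lemma conjugation_of_T:
  assumes X: "X ** (gbar ** g) = mat 1"
  shows "\<tau> \<otimes> T i j = (\<Oplus>k\<in>UNIV. \<Oplus>l\<in>UNIV. (X $ i $ k * (gbar ** g) $ l $ j) \<odot> T k l) \<otimes> \<tau>"
proof -
  have "\<tau> \<otimes> T i j = (\<Oplus>m\<in>UNIV. (X ** (gbar ** g)) $ i $ m \<odot> (\<tau> \<otimes> T m j))"
    by (simp add: X mat_def finsum_delta)
  also have "\<dots> = (\<Oplus>k\<in>UNIV. X $ i $ k \<odot> (\<Oplus>l\<in>UNIV. (gbar ** g) $ l $ j \<odot> (T k l \<otimes> \<tau>)))"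
    by (simp add: finsum_smult_matrix_mult contraction_exchange)
  also have "\<dots> = (\<Oplus>k\<in>UNIV. \<Oplus>l\<in>UNIV. (X $ i $ k * (gbar ** g) $ l $ j) \<odot> T k l) \<otimes> \<tau>"
    by (simp add: mult_finsum_left smult_finsum smult_smult mult_smult_left)
  finally show ?thesis .
qed

end

end

section \<open>Group-likeness of \<tau> and its commutation with \<open>T\<close>\<close>

theorem proposition3:
  fixes R :: "complex^('n::finite \<times> 'n)^('n \<times> 'n)"
    and q \<nu> :: complex
    and gbar g X :: "complex^'n^'n"
    and \<tau> :: "(('n \<times> 'n) list \<Rightarrow>\<^sub>0 complex) set"
  assumes "q \<notin> {0, 1, -1}"
    and "\<nu> \<notin> {0, q, - inverse q}"
    and "R_matrix R"
    and "skew_invertible R"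
    and "BMW_type q \<nu> R"
    and "\<forall>i j k l. K_hat q \<nu> R $ (i, j) $ (k, l) = gbar $ i $ j * g $ k $ l"
    and "X = (\<chi> i j. \<Sum>k\<in>UNIV. g $ j $ k * gbar $ k $ i)"
    and "\<tau> \<in> carrier (FRT R)"
    and "\<forall>i j k l.
      (\<Oplus>\<^bsub>FRT R\<^esub>a\<in>UNIV. \<Oplus>\<^bsub>FRT R\<^esub>b\<in>UNIV.
         K_hat q \<nu> R $ (i, j) $ (a, b) \<odot>\<^bsub>FRT R\<^esub> (FRT_gen R a k \<otimes>\<^bsub>FRT R\<^esub> FRT_gen R b l))
      = K_hat q \<nu> R $ (i, j) $ (k, l) \<odot>\<^bsub>FRT R\<^esub> \<tau>"
  shows "coproduct R \<tau> = pure_tensor (FRT R) (FRT R) \<tau> \<tau> \<and>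
    counit R \<tau> = 1 \<and>
    (\<forall>i j. \<tau> \<otimes>\<^bsub>FRT R\<^esub> FRT_gen R i j =
      (\<Oplus>\<^bsub>FRT R\<^esub>k\<in>UNIV. \<Oplus>\<^bsub>FRT R\<^esub>l\<in>UNIV.
         (X $ i $ k * matrix_inv X $ l $ j) \<odot>\<^bsub>FRT R\<^esub> FRT_gen R k l) \<otimes>\<^bsub>FRT R\<^esub> \<tau>)"
proof -
  let ?K = "K_hat q \<nu> R" and ?T = "FRT_gen R"
  let ?D = "double_matrix (FRT R) ?T" and ?FF = "tensor_algebra (FRT R) (FRT R)"
  interpret F: complex_alg "FRT R"
    by (rule complex_alg_FRT)
  interpret FF: alg_pair "FRT R" "FRT R" ..
  interpret C: complex_alg complex_algebra
    by (rule complex_alg_complex)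
  note \<tau> [simp] = \<open>\<tau> \<in> carrier (FRT R)\<close>
  have D [simp]: "?D p r \<in> carrier (FRT R)" for p r
    by simp
  have K: "?K $ p $ r = gbar $ fst p $ snd p * g $ fst r $ snd r" for p r
    using assms(6) by (cases p, cases r) simp
  have K_int: "F.intertwines ?K ?D"
    by (rule F.intertwines_K_hat) (simp_all add: FRT_gen_intertwines)
  have K_\<tau>: "(\<Oplus>\<^bsub>FRT R\<^esub>r\<in>UNIV. ?K $ p $ r \<odot>\<^bsub>FRT R\<^esub> ?D r s) = ?K $ p $ s \<odot>\<^bsub>FRT R\<^esub> \<tau>" for p s
    using assms(9)[rule_format, of "fst p" "snd p" "fst s" "snd s"]
    by (subst (asm) F.finsum_pairs) (simp_all add: double_matrix_def)
  have "q \<noteq> 0" "\<nu> \<noteq> 0" "q - inverse q \<noteq> 0"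
    using assms(1,2) by (auto simp: field_simps square_eq_1_iff)
  \<comment> \<open>This one nonzero entry serves for all cancellations below; rank one splits it
    into nonzero entries of \<open>gbar\<close> and \<open>g\<close>.\<close>
  then obtain p0 s0 where K0: "?K $ p0 $ s0 \<noteq> 0"
    using K_hat_nonzero assms(5) unfolding BMW_type_def by blast
  then have g0: "gbar $ fst p0 $ snd p0 \<noteq> 0" "g $ fst s0 $ snd s0 \<noteq> 0"
    by (auto simp: K)

  have "coproduct R \<tau> = pure_tensor (FRT R) (FRT R) \<tau> \<tau>"
  proof (rule FF.AB.smult_cancel[OF K0])
    have \<Delta>D: "coproduct R (?D r s) = FF.tensor_matrix_mult ?D ?D r s" for r s
      using fun_cong[OF fun_cong[OF FF.double_matrix_tensor_matrix_mult[of ?T ?T]], of r s]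
      by (simp add: double_matrix_def algebra_homD(2)[OF coproduct_hom] coproduct_gen)
    have "?K $ p0 $ s0 \<odot>\<^bsub>?FF\<^esub> coproduct R \<tau> = coproduct R (\<Oplus>\<^bsub>FRT R\<^esub>r\<in>UNIV. ?K $ p0 $ r \<odot>\<^bsub>FRT R\<^esub> ?D r s0)"
      by (simp add: K_\<tau> algebra_homD(5)[OF coproduct_hom])
    also have "\<dots> = (\<Oplus>\<^bsub>?FF\<^esub>r\<in>UNIV. ?K $ p0 $ r \<odot>\<^bsub>?FF\<^esub> FF.tensor_matrix_mult ?D ?D r s0)"
      by (subst algebra_hom_lincomb[OF F.complex_alg_axioms FF.AB.complex_alg_axioms coproduct_hom])
        (simp_all add: \<Delta>D)
    \<comment> \<open>The relation defining \<tau> is used in the left tensor slot; afterwards the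
      remaining sum is collected in the right slot, where the relation is used again.\<close>
    also have "\<dots> = (\<Oplus>\<^bsub>?FF\<^esub>s\<in>UNIV. ?K $ p0 $ s \<odot>\<^bsub>?FF\<^esub> pure_tensor (FRT R) (FRT R) \<tau> (?D s s0))"
      by (simp add: FF.tensor_matrix_mult_lincomb_left K_\<tau> FF.pure_tensor_smult)
    also have "\<dots> = pure_tensor (FRT R) (FRT R) \<tau> (\<Oplus>\<^bsub>FRT R\<^esub>s\<in>UNIV. ?K $ p0 $ s \<odot>\<^bsub>FRT R\<^esub> ?D s s0)"
      by (simp add: FF.pure_tensor_lincomb_right)
    also have "\<dots> = ?K $ p0 $ s0 \<odot>\<^bsub>?FF\<^esub> pure_tensor (FRT R) (FRT R) \<tau> \<tau>"
      by (simp add: K_\<tau> FF.pure_tensor_smult)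
    finally show "?K $ p0 $ s0 \<odot>\<^bsub>?FF\<^esub> coproduct R \<tau> = \<dots>" .
  qed (simp_all add: algebra_homD(1)[OF coproduct_hom])

  moreover have "counit R \<tau> = 1"
  proof -
    have \<epsilon>D: "counit R (?D r s) = (if r = s then 1 else 0)" for r s
      by (auto simp: double_matrix_def algebra_homD(2)[OF counit_hom] counit_gen complex_algebra_def prod_eq_iff)
    have "?K $ p0 $ s0 * counit R \<tau> = counit R (\<Oplus>\<^bsub>FRT R\<^esub>r\<in>UNIV. ?K $ p0 $ r \<odot>\<^bsub>FRT R\<^esub> ?D r s0)"
      by (simp add: K_\<tau> algebra_homD(5)[OF counit_hom]) (simp add: complex_algebra_def)
    \<comment> \<open>The counit turns \<open>T\<^sub>1 T\<^sub>2\<close> into the identity, so only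
      the term at \<open>s0\<close> survives.\<close>
    also have "\<dots> = (\<Oplus>\<^bsub>complex_algebra\<^esub>r\<in>UNIV. ?K $ p0 $ r \<odot>\<^bsub>complex_algebra\<^esub> (if r = s0 then 1 else 0))"
      by (subst algebra_hom_lincomb[OF F.complex_alg_axioms complex_alg_complex counit_hom]) (simp_all add: \<epsilon>D)
    also have "\<dots> = ?K $ p0 $ s0"
      using C.finsum_delta(2)[of "\<lambda>r. ?K $ p0 $ r" s0 1] by (simp add: complex_algebra_def mult.commute)
    finally show ?thesis
      using K0 by simp
  qed

  moreover have "\<tau> \<otimes>\<^bsub>FRT R\<^esub> ?T i j = (\<Oplus>\<^bsub>FRT R\<^esub>k\<in>UNIV. \<Oplus>\<^bsub>FRT R\<^esub>l\<in>UNIV.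
      (X $ i $ k * matrix_inv X $ l $ j) \<odot>\<^bsub>FRT R\<^esub> ?T k l) \<otimes>\<^bsub>FRT R\<^esub> \<tau>" for i j
  proof -
    have "X = transpose (g ** gbar)"
      by (simp add: assms(7) matrix_matrix_mult_def transpose_def vec_eq_iff)
    then have YX: "gbar ** g ** X = mat 1"
      using BMW_gbar_g_inverse[OF assms(1) \<open>\<nu> \<noteq> 0\<close> assms(5,6)] by simp
    then have XY: "X ** (gbar ** g) = mat 1"
      by (simp add: matrix_left_right_inverse)
    \<comment> \<open>\<open>matrix_inv\<close> is a choice among two-sided inverses, so one must
      first be exhibited; multiplication by \<open>gbar ** g\<close> from the left then pins the
      choice down.\<close>
    have inv: "matrix_inv X = gbar ** g"
    proof -
      have "\<exists>Y. X ** Y = mat 1 \<and> Y ** X = mat 1"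
        using XY YX by blast
      then have "X ** matrix_inv X = mat 1"
        unfolding matrix_inv_def by (rule someI2_ex) blast
      then have "gbar ** g ** (X ** matrix_inv X) = gbar ** g"
        by simp
      then show ?thesis
        unfolding matrix_mul_assoc YX by simp
    qed
    \<comment> \<open>Row \<open>p0\<close> of the relation for \<open>K\<close>, divided by the
      nonzero entry of \<open>gbar\<close>.\<close>
    have g: "(\<Oplus>\<^bsub>FRT R\<^esub>r\<in>UNIV. g $ fst r $ snd r \<odot>\<^bsub>FRT R\<^esub> ?D r s) = g $ fst s $ snd s \<odot>\<^bsub>FRT R\<^esub> \<tau>" for s
      by (rule F.smult_cancel[OF g0(1)]) (use K_\<tau>[of p0 s] in \<open>simp_all add: F.smult_finsum F.smult_smult K\<close>)
    \<comment> \<open>The relation defining \<tau> has \<open>K\<close> on the left of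
      \<open>T\<^sub>1 T\<^sub>2\<close>; intertwining moves it to the right, and column
      \<open>s0\<close> is divided by the nonzero entry of \<open>g\<close>.\<close>
    have gbar: "(\<Oplus>\<^bsub>FRT R\<^esub>r\<in>UNIV. gbar $ fst r $ snd r \<odot>\<^bsub>FRT R\<^esub> ?D p r) = gbar $ fst p $ snd p \<odot>\<^bsub>FRT R\<^esub> \<tau>" for p
    proof (rule F.smult_cancel[OF g0(2)])
      have "(\<Oplus>\<^bsub>FRT R\<^esub>r\<in>UNIV. ?K $ r $ s0 \<odot>\<^bsub>FRT R\<^esub> ?D p r) = ?K $ p $ s0 \<odot>\<^bsub>FRT R\<^esub> \<tau>"
        using K_int K_\<tau>[of p s0] unfolding F.intertwines_def by metis
      then show "g $ fst s0 $ snd s0 \<odot>\<^bsub>FRT R\<^esub> (\<Oplus>\<^bsub>FRT R\<^esub>r\<in>UNIV. gbar $ fst r $ snd r \<odot>\<^bsub>FRT R\<^esub> ?D p r) =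
        g $ fst s0 $ snd s0 \<odot>\<^bsub>FRT R\<^esub> (gbar $ fst p $ snd p \<odot>\<^bsub>FRT R\<^esub> \<tau>)"
        by (simp add: F.smult_finsum F.smult_smult K mult.commute)
    qed simp_all
    show ?thesis
      unfolding inv by (rule F.conjugation_of_T[OF FRT_gen_closed \<tau> g gbar XY])
  qed

  ultimately show ?thesis
    by blast
qed

end
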